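(* The Finite Sums matrix ${\bf F}$ is maximal among rapidly image partition regular matrices with integer entries. That is, ${\bf F}$ is rapidly image partition regular, and whenever $\vec r\in\mathbb Z^\omega$ is a row with only finitely many nonzero entries which is not a row of ${\bf F}$, the matrix $\left(\begin{array}{c}\vec r\\ {\bf F}\end{array}\right)$ (obtained by adjoining $\vec r$ to ${\bf F}$ as an extra row) is not rapidly image partition regular.
   Context: $\mathbb N=\{1,2,3,\ldots\}$, $\omega=\{0,1,2,\ldots\}$. All matrices have only finitely many nonzero entries in each row. The Finite Sums matrix ${\bf F}$ is the $\omega\times\omega$ matrix with all entries $f_{i,j}\in\{0,1\}$ such that for each $i<\omega$, $\sum_{j=0}^\infty f_{i,j}2^j=i+1$; so its rows are exactly the nonzero sequences in $\{0,1\}^\omega$ with finitely many $1$'s. Let $u,v\in\mathbb N\cup\{\omega\}$. A $u\times v$ matrix $A$ with rational entries is rapidly image partition regular if and only if whenever $\mathbb N$ is finitely coloured and $p$ is a prime, there exists $\vec x=\langle x_i\rangle_{i<v}\in\mathbb N^v$ such that the entries of $A\vec x$ are monochromatic (all entries are natural numbers of the same colour) and, whenever $i+1<v$ and $s\in\omega$, if $p^s\leq x_i$ then $p^{s+8}$ divides $x_{i+1}$. *)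

theory Defs
  imports Complex_Main "HOL-Library.Extended_Nat" "HOL-Computational_Algebra.Primes"
begin

text \<open>
  A \<open>u \<times> v\<close> matrix with \<open>u, v \<in> {1, 2, \<dots>} \<union> {\<omega>}\<close> is a function \<open>A :: nat \<Rightarrow> nat \<Rightarrow> _\<close>
  together with its dimensions \<open>u v :: enat\<close> (\<open>\<infinity>\<close> stands for \<open>\<omega>\<close>); the value \<open>A i j\<close> is
  meaningful only for \<open>i < u\<close> and \<open>j < v\<close>.  Rows are assumed to have finite support; under
  this assumption the following finite sum is the \<open>i\<close>-th entry of \<open>A x\<close>.
\<close>

definition mat_entry :: "enat \<Rightarrow> (nat \<Rightarrow> nat \<Rightarrow> rat) \<Rightarrow> (nat \<Rightarrow> nat) \<Rightarrow> nat \<Rightarrow> rat" where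
  "mat_entry v A x i = (\<Sum>j | enat j < v \<and> A i j \<noteq> 0. A i j * of_nat (x j))"

text \<open>
  The positive integers are \<open>{1..}\<close>; the value \<open>c 0\<close> of a colouring \<open>c\<close> plays no role.
\<close>

definition rapidly_ipr :: "enat \<Rightarrow> enat \<Rightarrow> (nat \<Rightarrow> nat \<Rightarrow> rat) \<Rightarrow> bool" where
  "rapidly_ipr u v A \<longleftrightarrow>
     (\<forall>(c :: nat \<Rightarrow> nat) (p :: nat). finite (c ` {1..}) \<and> prime p \<longrightarrow>
       (\<exists>x :: nat \<Rightarrow> nat.
          (\<forall>j. enat j < v \<longrightarrow> 1 \<le> x j) \<and>
          (\<exists>a. \<forall>i. enat i < u \<longrightarrow> (\<exists>n\<ge>1. mat_entry v A x i = of_nat n \<and> c n = a)) \<and>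
          (\<forall>i s. enat (i + 1) < v \<and> p ^ s \<le> x i \<longrightarrow> p ^ (s + 8) dvd x (i + 1))))"

text \<open>
  Convergence in \<open>int\<close> is with respect to the discrete topology, so the summability below
  already forces each row to have finite support.
\<close>

definition is_finite_sums_matrix :: "(nat \<Rightarrow> nat \<Rightarrow> int) \<Rightarrow> bool" where
  "is_finite_sums_matrix F \<longleftrightarrow>
     (\<forall>i. (\<forall>j. F i j \<in> {0, 1}) \<and> (\<lambda>j. F i j * 2 ^ j) sums (int i + 1))"

definition finite_sums_matrix :: "nat \<Rightarrow> nat \<Rightarrow> int" where
  "finite_sums_matrix = (THE F. is_finite_sums_matrix F)"

definition adjoin_row :: "(nat \<Rightarrow> 'a) \<Rightarrow> (nat \<Rightarrow> nat \<Rightarrow> 'a) \<Rightarrow> nat \<Rightarrow> nat \<Rightarrow> 'a" where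
  "adjoin_row r A i = (case i of 0 \<Rightarrow> r | Suc k \<Rightarrow> A k)"

lemma binary_sums_finite:
  fixes f :: "nat \<Rightarrow> int"
  assumes "(\<lambda>j. f j * 2 ^ j) sums n"
  shows "\<exists>N. (\<forall>j\<ge>N. f j = 0) \<and> n = (\<Sum>j<N. f j * 2 ^ j)"
proof -
  have "(\<lambda>k. \<Sum>j<k. f j * 2 ^ j) \<longlonglongrightarrow> n"
    using assms by (simp add: sums_def)
  then have "\<forall>\<^sub>F k in sequentially. (\<Sum>j<k. f j * 2 ^ j) = n"
    by (auto simp: tendsto_discrete)
  then obtain N where N: "\<And>k. k \<ge> N \<Longrightarrow> (\<Sum>j<k. f j * 2 ^ j) = n"
    by (auto simp: eventually_sequentially)
  have "f j = 0" if "j \<ge> N" for j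
    using N[OF that] N[of "Suc j"] that by simp
  then show ?thesis using N[of N] by auto
qed

lemma binary_digit_eq:
  fixes f :: "nat \<Rightarrow> int"
  assumes "\<And>j. f j \<in> {0, 1}" and "(\<lambda>j. f j * 2 ^ j) sums n"
  shows "f j = of_bool (bit n j)"
proof -
  obtain N where N: "\<forall>j\<ge>N. f j = 0" "n = (\<Sum>j<N. f j * 2 ^ j)"
    using binary_sums_finite[OF assms(2)] by auto
  have f: "f j = of_bool (f j = 1)" for j using assms(1)[of j] by auto
  have "n = horner_sum of_bool 2 (map (\<lambda>j. f j = 1) [0..<N])"
    unfolding horner_sum_eq_sum N(2) using f
    by (auto intro!: sum.cong simp: atLeast0LessThan)
  then have "bit n j \<longleftrightarrow> j < N \<and> f j = 1"
    by (auto simp: bit_horner_sum_bit_iff)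
  then show ?thesis using f[of j] N(1) by (cases "j < N") auto
qed

lemma bit_matrix_is_finite_sums_matrix:
  "is_finite_sums_matrix (\<lambda>i j. of_bool (bit (Suc i) j))"
proof -
  have "(\<lambda>j. of_bool (bit (Suc i) j) * 2 ^ j :: int) sums (int i + 1)" for i
  proof -
    have lt: "Suc i < 2 ^ Suc i" by (rule less_exp)
    have zero: "\<not> bit (Suc i) j" if "j \<ge> Suc i" for j
    proof -
      have "Suc i < 2 ^ j"
        using that by (meson le_less_trans less_exp)
      then show ?thesis by (simp add: bit_iff_odd)
    qed
    have "(\<Sum>j<Suc i. of_bool (bit (Suc i) j) * 2 ^ j) = take_bit (Suc i) (Suc i)"
      by (simp add: take_bit_sum push_bit_eq_mult atLeast0LessThan)
    also have "\<dots> = Suc i"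
      using lt by (simp add: take_bit_nat_eq_self)
    finally have "(\<Sum>j<Suc i. of_bool (bit (Suc i) j) * 2 ^ j :: int) = int (Suc i)"
      by (metis (mono_tags, lifting) of_nat_sum of_nat_mult of_nat_of_bool of_nat_power
          of_nat_numeral sum.cong)
    moreover have "(\<lambda>j. of_bool (bit (Suc i) j) * 2 ^ j :: int) sums
        (\<Sum>j<Suc i. of_bool (bit (Suc i) j) * 2 ^ j)"
      by (rule sums_finite) (use zero in auto)
    ultimately show ?thesis by (simp add: add.commute)
  qed
  then show ?thesis by (simp add: is_finite_sums_matrix_def)
qed

lemma is_finite_sums_matrix_unique:
  assumes "is_finite_sums_matrix F" "is_finite_sums_matrix G"
  shows "F = G"
proof (intro ext)
  fix i j
  show "F i j = G i j"
    using assms binary_digit_eq[of "F i" "int i + 1" j] binary_digit_eq[of "G i" "int i + 1" j]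
    by (simp add: is_finite_sums_matrix_def)
qed

lemma is_finite_sums_matrix_finite_sums_matrix:
  "is_finite_sums_matrix finite_sums_matrix"
  unfolding finite_sums_matrix_def
  by (rule theI'[of is_finite_sums_matrix])
     (use bit_matrix_is_finite_sums_matrix is_finite_sums_matrix_unique in blast)

lemma finite_sums_matrix_eq:
  "finite_sums_matrix i j = of_bool (bit (Suc i) j)"
  by (rule fun_cong[OF fun_cong[OF is_finite_sums_matrix_unique[OF
      is_finite_sums_matrix_finite_sums_matrix bit_matrix_is_finite_sums_matrix]]])

lemma finite_support_finite_sums_matrix:
  "finite {j. finite_sums_matrix i j \<noteq> 0}"
proof -
  have "(\<lambda>j. finite_sums_matrix i j * 2 ^ j) sums (int i + 1)"
    using is_finite_sums_matrix_finite_sums_matrix by (simp add: is_finite_sums_matrix_def)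
  then obtain N where "\<forall>j\<ge>N. finite_sums_matrix i j = 0"
    using binary_sums_finite by blast
  then have "{j. finite_sums_matrix i j \<noteq> 0} \<subseteq> {..<N}"
    using leI by auto
  then show ?thesis using finite_subset by blast
qed

end

theory Submission
  imports Defs
begin

text \<open>
  Regularity of the Finite Sums matrix is Hindman's theorem: pick an idempotent ultrafilter containing
  all sets of positive multiples, and choose each \<open>x (i + 1)\<close> divisible by a high power of \<open>p\<close>.

  For maximality let \<open>r\<close> have an entry outside \<open>{0, 1}\<close> and take \<open>p\<close> large compared to \<open>r\<close>.
  Consider, in the balanced base \<open>p\<close> expansion of \<open>n\<close>, the pairs of consecutive nonzero digits, each
  labelled by the leading size \<open>A\<close> of the part of \<open>n\<close> up to the lower digit and by the residue \<open>b\<close>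
  of the upper digit. The number of pairs with label \<open>(A, b)\<close> is additive on sums of widely separated
  numbers, except for the one pair formed at the junction. Colour \<open>n\<close> by its last nonzero digit and,
  for every \<open>v\<close> that is 1 or an entry of \<open>r\<close>, by the leading size of \<open>v * n\<close> and by these numbers
  for \<open>v * n\<close> modulo a large \<open>q\<close>. Let \<open>r m\<close> be the first entry outside \<open>{0, 1}\<close>, \<open>A\<close> the common
  leading size of the \<open>x i\<close> and \<open>b\<close> the last nonzero digit of \<open>r m * x m\<close>. Monochromaticity forces
  the count for \<open>(A, b)\<close> to vanish modulo \<open>q\<close> on every \<open>v * x i\<close> and on the new entry. But in the
  new entry the junction in front of \<open>r m * x m\<close> contributes, and altogether there are fewer than \<open>q\<close>
  contributing junctions. If there is no such junction because \<open>r m\<close> is the first nonzero entry, then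
  the last nonzero digits differ.
\<close>

section \<open>Idempotent ultrafilters and Hindman's theorem\<close>

text \<open>For ultrafilters this is the extension of addition to the space of ultrafilters:
  \<open>P\<close> is large when, for \<open>F\<close>-most \<open>m\<close>, its translate by
  \<open>m\<close> is \<open>G\<close>-large.\<close>

definition filter_add :: "'a::semigroup_add filter \<Rightarrow> 'a filter \<Rightarrow> 'a filter" where
  "filter_add F G = Abs_filter (\<lambda>P. eventually (\<lambda>m. eventually (\<lambda>n. P (m + n)) G) F)"

lemma eventually_filter_add:
  "eventually P (filter_add F G) \<longleftrightarrow> eventually (\<lambda>m. eventually (\<lambda>n. P (m + n)) G) F"
  unfolding filter_add_def
proof (rule eventually_Abs_filter, rule is_filter.intro)
  fix P Q :: "'a \<Rightarrow> bool"
  assume imp: "\<forall>x. P x \<longrightarrow> Q x" and P: "\<forall>\<^sub>F m in F. \<forall>\<^sub>F n in G. P (m + n)"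
  have "eventually (\<lambda>n. P (m + n)) G \<longrightarrow> eventually (\<lambda>n. Q (m + n)) G" for m
    using imp by (auto elim: eventually_mono)
  with P show "\<forall>\<^sub>F m in F. \<forall>\<^sub>F n in G. Q (m + n)" by (auto elim: eventually_mono)
qed (simp_all add: eventually_conj_iff)

lemma filter_add_assoc:
  "filter_add (filter_add F G) H = filter_add F (filter_add G H)"
  by (simp add: filter_eq_iff eventually_filter_add add.assoc)

lemma filter_add_mono:
  assumes "F \<le> F'" "G \<le> G'"
  shows "filter_add F G \<le> filter_add F' G'"
  using assms unfolding le_filter_def eventually_filter_add by (metis (mono_tags, lifting) eventually_mono)

lemma filter_add_eq_bot_iff: "filter_add F G = bot \<longleftrightarrow> F = bot \<or> G = bot"
  unfolding trivial_limit_def eventually_filter_add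
  by (cases "eventually (\<lambda>_. False) G") simp_all

section \<open>Minimal filters, ultrafilters and the Ellis lemma\<close>

lemma eventually_Inf_chain:
  fixes C :: "'a filter set"
  assumes "C \<noteq> {}" "\<forall>F\<in>C. \<forall>G\<in>C. F \<le> G \<or> G \<le> F"
  shows "eventually P (Inf C) \<longleftrightarrow> (\<exists>F\<in>C. eventually P F)"
  by (rule eventually_Inf_base[OF assms(1)])
     (use assms(2) in \<open>metis inf.absorb1 inf.absorb2 order_refl\<close>)

text \<open>Compactness in filter form: the infimum of a chain of proper filters is proper, because
  whatever holds eventually there already does so in one member.\<close>

lemma filter_zorn:
  fixes F\<^sub>0 :: "'a filter"
  assumes Q: "Q F\<^sub>0" and ne: "F\<^sub>0 \<noteq> bot"
    and chain: "\<And>C. \<lbrakk>C \<noteq> {}; \<forall>F\<in>C. Q F \<and> F \<noteq> bot; \<forall>F\<in>C. \<forall>G\<in>C. F \<le> G \<or> G \<le> F\<rbrakk> \<Longrightarrow> Q (Inf C)"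
  obtains F where "F \<le> F\<^sub>0" "Q F" "F \<noteq> bot"
    "\<And>G. \<lbrakk>G \<le> F; Q G; G \<noteq> bot\<rbrakk> \<Longrightarrow> G = F"
proof -
  define A where "A = {F. F \<le> F\<^sub>0 \<and> Q F \<and> F \<noteq> bot}"
  have "\<exists>m\<in>A. \<forall>a\<in>A. m \<ge> a \<longrightarrow> a = m"
  proof (rule predicate_Zorn)
    show "partial_order_on A (relation_of (\<ge>) A)"
      by (rule partial_order_on_relation_ofI) auto
  next
    fix C assume "C \<in> Chains (relation_of (\<ge>) A)"
    then have sub: "C \<subseteq> A" and lin: "\<forall>F\<in>C. \<forall>G\<in>C. F \<le> G \<or> G \<le> F"
      by (auto simp: Chains_def relation_of_def)
    show "\<exists>u\<in>A. \<forall>a\<in>C. a \<ge> u"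
    proof (cases "C = {}")
      case True
      then show ?thesis using Q ne by (auto simp: A_def)
    next
      case False
      have "Inf C \<noteq> bot"
        unfolding trivial_limit_def eventually_Inf_chain[OF False lin]
        using sub by (auto simp: A_def trivial_limit_def)
      moreover have "Q (Inf C)"
        using chain[OF False] sub lin by (auto simp: A_def)
      moreover have "Inf C \<le> F\<^sub>0"
        using False sub by (auto simp: A_def intro: Inf_lower2)
      ultimately show ?thesis
        by (auto simp: A_def intro!: bexI[of _ "Inf C"] Inf_lower)
    qed
  qed
  then show thesis using that by (auto simp: A_def)
qed

definition ultrafilter :: "'a filter \<Rightarrow> bool" where
  "ultrafilter U \<longleftrightarrow> U \<noteq> bot \<and> (\<forall>P. eventually P U \<or> eventually (\<lambda>x. \<not> P x) U)"

text \<open>A minimal proper filter decides every \<open>P\<close>: if restricting it to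
  \<open>P\<close> leaves it proper, minimality says that nothing has changed.\<close>

lemma ex_ultrafilter_le:
  assumes "F \<noteq> bot"
  obtains U where "U \<le> F" "ultrafilter U"
proof -
  obtain U where U: "U \<le> F" "U \<noteq> bot" and min: "\<And>G. \<lbrakk>G \<le> U; G \<noteq> bot\<rbrakk> \<Longrightarrow> G = U"
    by (rule filter_zorn[of "\<lambda>_. True", OF TrueI assms TrueI]) blast
  have "eventually P U \<or> eventually (\<lambda>x. \<not> P x) U" for P
  proof (cases "inf U (principal {x. P x}) = bot")
    case True
    then show ?thesis
      by (simp add: trivial_limit_def eventually_inf_principal)
  next
    case False
    then have "inf U (principal {x. P x}) = U" by (intro min) auto
    then have "U \<le> principal {x. P x}" by (simp add: inf.absorb_iff1)
    then show ?thesis by (simp add: le_principal)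
  qed
  with U that show thesis by (auto simp: ultrafilter_def)
qed

text \<open>
  The Ellis lemma, with filters in place of closed subsets of \<open>\<beta>S\<close>: a filter \<open>F\<close> with
  \<open>filter_add F F \<le> F\<close> plays the role of a closed subsemigroup.
\<close>

lemma ex_idempotent_ultrafilter_le:
  fixes F\<^sub>0 :: "'a::semigroup_add filter"
  assumes "F\<^sub>0 \<noteq> bot" "filter_add F\<^sub>0 F\<^sub>0 \<le> F\<^sub>0"
  obtains U where "U \<le> F\<^sub>0" "ultrafilter U" "filter_add U U = U"
proof -
  have chain: "filter_add (Inf C) (Inf C) \<le> Inf C"
    if C: "C \<noteq> {}" "\<forall>F\<in>C. filter_add F F \<le> F \<and> F \<noteq> bot" "\<forall>F\<in>C. \<forall>G\<in>C. F \<le> G \<or> G \<le> F"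
    for C :: "'a filter set"
  proof (rule Inf_greatest)
    fix F assume F: "F \<in> C"
    then have "filter_add (Inf C) (Inf C) \<le> filter_add F F"
      by (intro filter_add_mono Inf_lower)
    then show "filter_add (Inf C) (Inf C) \<le> F" using C F by (meson order_trans)
  qed
  obtain F where F: "F \<le> F\<^sub>0" "filter_add F F \<le> F" "F \<noteq> bot"
    and min: "\<And>G. \<lbrakk>G \<le> F; filter_add G G \<le> G; G \<noteq> bot\<rbrakk> \<Longrightarrow> G = F"
    by (rule filter_zorn[of "\<lambda>F. filter_add F F \<le> F", OF assms(2,1) chain]) blast+
  obtain U where U: "U \<le> F" "ultrafilter U" using ex_ultrafilter_le[OF F(3)] .
  then have Ubot: "U \<noteq> bot" and Uult: "\<And>P. eventually P U \<or> eventually (\<lambda>x. \<not> P x) U"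
    by (auto simp: ultrafilter_def)
  \<comment> \<open>\<open>filter_add F U\<close> is again a closed subsemigroup inside
    \<open>F\<close>, so minimality applies.\<close>
  have FU: "filter_add F U = F"
  proof (rule min)
    show "filter_add F U \<le> F"
      using filter_add_mono[OF order_refl U(1)] F(2) by (rule order_trans)
    have "filter_add (filter_add F U) (filter_add F U) = filter_add F (filter_add (filter_add U F) U)"
      by (simp add: filter_add_assoc)
    also have "\<dots> \<le> filter_add F (filter_add F U)"
      using filter_add_mono[OF U(1) order_refl, of F] F(2)
      by (intro filter_add_mono order_refl) (rule order_trans)
    also have "\<dots> \<le> filter_add F U"
      using filter_add_mono[OF F(2) order_refl, of U] by (simp add: filter_add_assoc)
    finally show "filter_add (filter_add F U) (filter_add F U) \<le> filter_add F U" .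
    show "filter_add F U \<noteq> bot" using F(3) Ubot by (simp add: filter_add_eq_bot_iff)
  qed
  \<comment> \<open>\<open>H\<close> corresponds to the closed semigroup of those \<open>W \<le> F\<close> with \<open>filter_add W U \<le> U\<close>;
    minimality of \<open>F\<close> makes it all of \<open>F\<close>.\<close>
  define S where "S A m \<longleftrightarrow> eventually (\<lambda>n. A (m + n)) U" for A :: "'a \<Rightarrow> bool" and m
  define H where "H = Abs_filter (\<lambda>P. \<exists>B A. eventually B F \<and> eventually A U \<and>
    (\<forall>m. B m \<and> S A m \<longrightarrow> P m))"
  have ev_H: "eventually P H \<longleftrightarrow> (\<exists>B A. eventually B F \<and> eventually A U \<and>
    (\<forall>m. B m \<and> S A m \<longrightarrow> P m))" for P
    unfolding H_def
  proof (rule eventually_Abs_filter, unfold is_filter_def, intro conjI allI impI)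
    show "\<exists>B A. eventually B F \<and> eventually A U \<and> (\<forall>m. B m \<and> S A m \<longrightarrow> True)"
      by (auto intro: exI[of _ "\<lambda>_. True"])
  next
    fix P Q
    assume "\<exists>B A. eventually B F \<and> eventually A U \<and> (\<forall>m. B m \<and> S A m \<longrightarrow> P m)"
      "\<exists>B A. eventually B F \<and> eventually A U \<and> (\<forall>m. B m \<and> S A m \<longrightarrow> Q m)"
    then obtain B A B' A' where *: "eventually B F" "eventually A U" "\<forall>m. B m \<and> S A m \<longrightarrow> P m"
      "eventually B' F" "eventually A' U" "\<forall>m. B' m \<and> S A' m \<longrightarrow> Q m" by blast
    then show "\<exists>B A. eventually B F \<and> eventually A U \<and> (\<forall>m. B m \<and> S A m \<longrightarrow> P m \<and> Q m)"
      by (intro exI[of _ "\<lambda>m. B m \<and> B' m"] exI[of _ "\<lambda>m. A m \<and> A' m"])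
         (auto simp: eventually_conj_iff S_def)
  next
    fix P Q :: "'a \<Rightarrow> bool"
    assume "\<forall>x. P x \<longrightarrow> Q x"
      "\<exists>B A. eventually B F \<and> eventually A U \<and> (\<forall>m. B m \<and> S A m \<longrightarrow> P m)"
    then show "\<exists>B A. eventually B F \<and> eventually A U \<and> (\<forall>m. B m \<and> S A m \<longrightarrow> Q m)" by meson
  qed
  have HF: "H \<le> F"
    unfolding le_filter_def ev_H by (metis eventually_True)
  have S_H: "eventually (S A) H" if "eventually A U" for A
    unfolding ev_H using that by (metis eventually_True)
  have HU: "filter_add H U \<le> U"
    using S_H unfolding le_filter_def eventually_filter_add S_def by blast
  have "H = F"
  proof (rule min[OF HF])
    show "filter_add H H \<le> H"
      unfolding le_filter_def
    proof (intro allI impI)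
      fix P assume "eventually P H"
      then obtain B A where BA: "eventually B F" "eventually A U" "\<forall>m. B m \<and> S A m \<longrightarrow> P m"
        unfolding ev_H by blast
      have "filter_add H H \<le> F"
        using filter_add_mono[OF HF HF] F(2) by (rule order_trans)
      then have "eventually B (filter_add H H)" using BA(1) by (simp add: le_filter_def)
      moreover have "eventually (S A) (filter_add H H)"
      proof -
        have "filter_add (filter_add H H) U \<le> U"
          using filter_add_mono[OF order_refl HU, of H] HU by (simp add: filter_add_assoc)
        then have "eventually A (filter_add (filter_add H H) U)"
          using BA(2) by (simp add: le_filter_def)
        then show ?thesis unfolding eventually_filter_add[of A] S_def .
      qed
      ultimately show "eventually P (filter_add H H)"
        by eventually_elim (use BA(3) in blast)
    qed
    \<comment> \<open>If \<open>H\<close> were trivial, \<open>A (m + n)\<close> would fail for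
      \<open>F\<close>-most \<open>m\<close> and \<open>U\<close>-most \<open>n\<close>; by
      \<open>FU\<close>, \<open>A\<close> would fail for \<open>F\<close>-most points, hence for
      \<open>U\<close>-most.\<close>
    show "H \<noteq> bot"
    proof
      assume "H = bot"
      then have "eventually (\<lambda>_. False) H" by simp
      then obtain B A where BA: "eventually B F" "eventually A U" "\<forall>m. \<not> (B m \<and> S A m)"
        unfolding ev_H by blast
      from BA(1) have "eventually (\<lambda>m. eventually (\<lambda>n. \<not> A (m + n)) U) F"
        by eventually_elim (use BA(3) Uult in \<open>auto simp: S_def\<close>)
      then have "eventually (\<lambda>n. \<not> A n) F"
        using FU eventually_filter_add[of "\<lambda>n. \<not> A n" F U] by simp
      then have "eventually (\<lambda>n. \<not> A n) U" using U(1) by (simp add: le_filter_def)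
      with BA(2) have "eventually (\<lambda>_. False) U" by eventually_elim simp
      then show False using Ubot by (simp add: trivial_limit_def)
    qed
  qed
  then have "F = U" using HU FU U(1) by simp
  then show thesis using that[OF _ U(2)] F(1) FU by simp
qed

section \<open>Hindman's theorem with prescribed divisibility\<close>

definition multiples_filter :: "nat filter" where
  "multiples_filter = (INF d\<in>{1..}. principal {n. 1 \<le> n \<and> d dvd n})"

lemma eventually_multiples_filter:
  "eventually P multiples_filter \<longleftrightarrow> (\<exists>d\<ge>1. \<forall>n\<ge>1. d dvd n \<longrightarrow> P n)"
  unfolding multiples_filter_def
proof (subst eventually_INF_base)
  fix a b :: nat assume "a \<in> {1..}" "b \<in> {1..}"
  then show "\<exists>x\<in>{1..}. principal {n. 1 \<le> n \<and> x dvd n}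
      \<le> inf (principal {n. 1 \<le> n \<and> a dvd n}) (principal {n. 1 \<le> n \<and> b dvd n})"
    by (intro bexI[of _ "a * b"]) (auto intro: dvd_mult_left dvd_mult_right)
qed (auto simp: eventually_principal)

lemma multiples_filter_ne_bot: "multiples_filter \<noteq> bot"
  unfolding trivial_limit_def eventually_multiples_filter by auto

lemma filter_add_multiples_filter: "filter_add multiples_filter multiples_filter \<le> multiples_filter"
  unfolding le_filter_def
proof (intro allI impI)
  fix P assume "eventually P multiples_filter"
  then obtain d where d: "d \<ge> 1" "\<And>n. \<lbrakk>n \<ge> 1; d dvd n\<rbrakk> \<Longrightarrow> P n"
    unfolding eventually_multiples_filter by blast
  show "eventually P (filter_add multiples_filter multiples_filter)"
    unfolding eventually_filter_add eventually_multiples_filter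
    using d by (intro exI[of _ d] conjI allI impI) auto
qed

text \<open>The Galvin-Glazer argument: \<open>U\<close>-most numbers keep all sums in the right
  colour, and \<open>U\<close>-most are multiples of any given power of \<open>p\<close>, so the
  next term can meet both demands.\<close>

lemma hindman_rapid:
  fixes c :: "nat \<Rightarrow> nat" and p :: nat
  assumes fin: "finite (c ` {1..})" and p: "p \<ge> 2"
  obtains x :: "nat \<Rightarrow> nat" and a where "\<And>j. 1 \<le> x j"
    "\<And>S. \<lbrakk>finite S; S \<noteq> {}\<rbrakk> \<Longrightarrow> c (\<Sum>j\<in>S. x j) = a"
    "\<And>i s. p ^ s \<le> x i \<Longrightarrow> p ^ (s + 8) dvd x (i + 1)"
proof -
  obtain U where U: "U \<le> multiples_filter" "ultrafilter U" "filter_add U U = U"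
    using ex_idempotent_ultrafilter_le[OF multiples_filter_ne_bot filter_add_multiples_filter] .
  have Ubot: "U \<noteq> bot" and Uult: "\<And>P. eventually P U \<or> eventually (\<lambda>x. \<not> P x) U"
    using U(2) by (auto simp: ultrafilter_def)
  have mult: "eventually (\<lambda>n. 1 \<le> n \<and> d dvd n) U" if "d \<ge> 1" for d
    by (rule filter_leD[OF U(1)]) (use that in \<open>auto simp: eventually_multiples_filter\<close>)
  obtain a where a: "eventually (\<lambda>n. c n = a) U"
  proof (rule ccontr)
    assume "\<not> thesis"
    then have "\<forall>b\<in>c ` {1..}. eventually (\<lambda>n. c n \<noteq> b) U" using that Uult by blast
    then have "eventually (\<lambda>n. \<forall>b\<in>c ` {1..}. c n \<noteq> b) U" 
      by (rule eventually_ball_finite[OF fin])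
    with mult[OF order_refl] have "eventually (\<lambda>_. False) U" by eventually_elim auto
    then show False using Ubot by (simp add: trivial_limit_def)
  qed
  \<comment> \<open>The usual refinement of the colour class: by \<open>evA'\<close>, from a member
    of \<open>A\<close> adding \<open>U\<close>-most numbers leads into \<open>A\<close>
    again.\<close>
  define A where "A n \<longleftrightarrow> c n = a \<and> eventually (\<lambda>k. c (n + k) = a) U" for n
  have UU: "eventually (\<lambda>m. eventually (\<lambda>n. P (m + n)) U) U \<longleftrightarrow> eventually P U" for P
    using eventually_filter_add[of P U U] U(3) by simp
  have evA: "eventually A U"
    unfolding A_def using a UU[of "\<lambda>n. c n = a"] by (simp add: eventually_conj_iff)
  have evA': "eventually (\<lambda>k. A (n + k)) U" if "A n" for n
    using that UU[of "\<lambda>k. c (n + k) = a"] unfolding A_def eventually_conj_iff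
    by (simp add: add.assoc)
  define good where "good s \<longleftrightarrow> eventually (\<lambda>k. A (s + k)) U" for s
  \<comment> \<open>A state holds all sums formed so far and the latest term. It starts with the
    empty sum 0 and the placeholder 0 as latest term.\<close>
  define inv where "inv st \<longleftrightarrow> finite (fst st) \<and> (\<forall>s\<in>fst st. good s)" for st :: "nat set \<times> nat"
  define nxt where "nxt st st' \<longleftrightarrow> snd st' \<ge> 1 \<and> p ^ (snd st + 8) dvd snd st' \<and>
    (\<forall>s\<in>fst st. A (s + snd st')) \<and> fst st' = fst st \<union> (\<lambda>s. s + snd st') ` fst st"
    for st st' :: "nat set \<times> nat"
  have step: "\<exists>st'. inv st' \<and> nxt st st'" if "inv st" for st
  proof -
    have "eventually (\<lambda>k. \<forall>s\<in>fst st. A (s + k)) U"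
      using that by (simp add: inv_def good_def eventually_ball_finite_distrib)
    moreover have "eventually (\<lambda>n. 1 \<le> n \<and> p ^ (snd st + 8) dvd n) U"
      by (rule mult) (use p in auto)
    ultimately have "eventually (\<lambda>k. (\<forall>s\<in>fst st. A (s + k)) \<and> 1 \<le> k \<and> p ^ (snd st + 8) dvd k) U"
      by eventually_elim auto
    then obtain k where k: "\<forall>s\<in>fst st. A (s + k)" "1 \<le> k" "p ^ (snd st + 8) dvd k"
      using eventually_happens'[OF Ubot] by blast
    then show ?thesis
      using that evA' by (intro exI[of _ "(fst st \<union> (\<lambda>s. s + k) ` fst st, k)"])
        (auto simp: inv_def nxt_def good_def)
  qed
  have "inv ({0}, 0)" using evA by (simp add: inv_def good_def)
  then obtain f where f0: "f 0 = ({0}, 0)" and f: "\<And>n. inv (f n)" "\<And>n. nxt (f n) (f (Suc n))"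
    using dependent_nat_choice[of "\<lambda>n st. inv st \<and> (n = 0 \<longrightarrow> st = ({0}, 0))" "\<lambda>n. nxt"] step
    by (metis (no_types, lifting) nat.discI)
  define x where "x j = snd (f (Suc j))" for j
  have fst_f: "fst (f (Suc n)) = fst (f n) \<union> (\<lambda>s. s + x n) ` fst (f n)"
    and x1: "1 \<le> x n" and xA: "\<forall>s\<in>fst (f n). A (s + x n)" for n
    using f(2)[of n] by (auto simp: nxt_def x_def)
  have sums: "(\<Sum>j\<in>S. x j) \<in> fst (f n)" if "S \<subseteq> {..<n}" for S n
    using that
  proof (induction n arbitrary: S)
    case 0
    then show ?case by (simp add: f0)
  next
    case (Suc n)
    have "finite S" using Suc.prems finite_subset by blast
    have "S - {n} \<subseteq> {..<n}" using Suc.prems by auto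
    then have "sum x (S - {n}) \<in> fst (f n)" by (rule Suc.IH)
    then show ?case
      using \<open>finite S\<close> unfolding fst_f
      by (cases "n \<in> S") (auto simp: sum.remove add.commute)
  qed
  show thesis
  proof (rule that[of x a, OF x1])
    fix S :: "nat set" assume S: "finite S" "S \<noteq> {}"
    define n where "n = Max S"
    have "n \<in> S" "S - {n} \<subseteq> {..<n}" using S unfolding n_def by (auto simp: less_le)
    then have "A (sum x (S - {n}) + x n)" using sums xA by blast
    moreover have "sum x (S - {n}) + x n = sum x S"
      using \<open>n \<in> S\<close> S by (simp add: sum.remove add.commute)
    ultimately show "c (sum x S) = a" by (simp add: A_def)
  next
    fix i s assume "p ^ s \<le> x i"
    \<comment> \<open>The recursion provides the exponent \<open>x i + 8\<close>, which suffices
      because \<open>s < p ^ s \<le> x i\<close>.\<close>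
    moreover have "s < p ^ s" using p by (intro power_gt_expt) simp
    ultimately have "p ^ (s + 8) dvd p ^ (x i + 8)" by (intro le_imp_power_dvd) simp
    also have "\<dots> dvd x (i + 1)" using f(2)[of "Suc i"] by (simp add: nxt_def x_def)
    finally show "p ^ (s + 8) dvd x (i + 1)" .
  qed
qed

section \<open>Regularity of the Finite Sums matrix\<close>

lemma ex_row_of_set:
  fixes S :: "nat set"
  assumes "finite S" "S \<noteq> {}"
  obtains i where "\<And>j. bit (Suc i) j \<longleftrightarrow> j \<in> S"
proof -
  have "\<exists>n::nat. \<forall>j. bit n j \<longleftrightarrow> j \<in> S"
    using assms(1)
  proof induction
    case (insert k S)
    then obtain n :: nat where "\<forall>j. bit n j \<longleftrightarrow> j \<in> S" by blast
    then have "\<forall>j. bit (set_bit k n) j \<longleftrightarrow> j \<in> insert k S" by (auto simp: bit_set_bit_iff)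
    then show ?case by blast
  qed (auto intro: exI[of _ 0])
  then obtain n :: nat where n: "\<forall>j. bit n j \<longleftrightarrow> j \<in> S" by blast
  with assms(2) have "n \<noteq> 0" by auto
  with n that show thesis by (metis not0_implies_Suc)
qed

lemma mat_entry_finite_sums_matrix:
  "mat_entry \<infinity> (\<lambda>i j. rat_of_int (finite_sums_matrix i j)) x i = of_nat (\<Sum>j | bit (Suc i) j. x j)"
  by (simp add: mat_entry_def finite_sums_matrix_eq)

lemma rapidly_ipr_finite_sums_matrix:
  "rapidly_ipr \<infinity> \<infinity> (\<lambda>i j. rat_of_int (finite_sums_matrix i j))"
  unfolding rapidly_ipr_def mat_entry_finite_sums_matrix
proof (intro allI impI)
  fix c :: "nat \<Rightarrow> nat" and p :: nat
  assume "finite (c ` {1..}) \<and> prime p"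
  then obtain x :: "nat \<Rightarrow> nat" and a where x: "\<And>j. 1 \<le> x j"
    "\<And>S. \<lbrakk>finite S; S \<noteq> {}\<rbrakk> \<Longrightarrow> c (\<Sum>j\<in>S. x j) = a"
    "\<And>i s. p ^ s \<le> x i \<Longrightarrow> p ^ (s + 8) dvd x (i + 1)"
    using hindman_rapid[of c p] prime_ge_2_nat by blast
  have "1 \<le> (\<Sum>j | bit (Suc i) j. x j) \<and> c (\<Sum>j | bit (Suc i) j. x j) = a" for i
  proof -
    have fin: "finite {j. bit (Suc i) j}"
      using finite_support_finite_sums_matrix[of i] by (simp add: finite_sums_matrix_eq)
    obtain j where j: "bit (Suc i) j"
      by (metis bit_0_eq bit_eq_iff bot_apply bot_bool_def nat.discI)
    have "x j \<le> (\<Sum>j | bit (Suc i) j. x j)" using fin j by (intro member_le_sum) auto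
    with x(1)[of j] x(2)[OF fin] j show ?thesis by fastforce
  qed
  with x(1,3) show "\<exists>x. (\<forall>j. enat j < \<infinity> \<longrightarrow> 1 \<le> x j) \<and>
      (\<exists>a. \<forall>i. enat i < \<infinity> \<longrightarrow>
        (\<exists>n\<ge>1. rat_of_nat (\<Sum>j | bit (Suc i) j. x j) = of_nat n \<and> c n = a)) \<and>
      (\<forall>i s. enat (i + 1) < \<infinity> \<and> p ^ s \<le> x i \<longrightarrow> p ^ (s + 8) dvd x (i + 1))"
    by blast
qed

section \<open>Leading sizes and splittings in base \<open>p\<close>\<close>

text \<open>
  \<open>lead\<close> records the size of \<open>z\<close> up to a power of \<open>p\<close> and a factor 2; it is empty when
  \<open>z \<le> 0\<close>. Since 3 is coprime to \<open>2 * p\<close>, a multiple of \<open>p ^ T\<close> stays at distance at least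
  \<open>p ^ T / 3\<close> from the thresholds \<open>2 ^ i * p ^ s / 3\<close>, so that adding something much smaller
  than \<open>p ^ T\<close> does not change \<open>lead\<close>.
\<close>

definition lead :: "int \<Rightarrow> int \<Rightarrow> nat set" where
  "lead p z = {i. 2 ^ i < p \<and> (\<exists>s. 2 ^ i * p ^ s < 3 * z \<and> 3 * z < 2 ^ (i + 1) * p ^ s)}"

text \<open>For \<open>0 < b < p\<close> this says that the lowest nonzero base \<open>p\<close>
  digit of \<open>y\<close>, taken as a residue, is \<open>b\<close>; negative \<open>y\<close> are
  covered too.\<close>

definition lowdig :: "int \<Rightarrow> int \<Rightarrow> int \<Rightarrow> bool" where
  "lowdig p y b \<longleftrightarrow> (\<exists>t u. y = p ^ t * (p * u + b))"

text \<open>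
  For \<open>0 < b < p\<close>, an element \<open>y\<close> of \<open>splits p A b n\<close> is the upper part of \<open>n\<close> in its balanced base
  \<open>p\<close> expansion, cut directly below a nonzero digit congruent to \<open>b\<close>, such that the remaining lower
  part is nonzero and has leading size \<open>A\<close>. Balanced expansions make negative coefficients harmless.
\<close>

definition splits :: "int \<Rightarrow> nat set \<Rightarrow> int \<Rightarrow> int \<Rightarrow> int set" where
  "splits p A b n =
    {y. (\<exists>t u. y = p ^ t * (p * u + b) \<and> 2 * \<bar>n - y\<bar> < p ^ t) \<and> y \<noteq> n \<and> lead p (n - y) = A}"

lemma splitsI:
  "\<lbrakk>y = p ^ t * (p * u + b); 2 * \<bar>n - y\<bar> < p ^ t; y \<noteq> n; lead p (n - y) = A\<rbrakk>
    \<Longrightarrow> y \<in> splits p A b n"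
  unfolding splits_def by blast

text \<open>The prime 3 divides neither 2 nor the prime \<open>p > 3\<close>; hence no integer lies
  on a threshold of \<open>lead\<close>.\<close>

lemma pow2_mult_power_neq_3_mult:
  fixes p :: int
  assumes "prime p" "p > 3"
  shows "2 ^ i * p ^ s \<noteq> 3 * m"
proof
  assume "2 ^ i * p ^ s = 3 * m"
  then have "3 dvd 2 ^ i * p ^ s" by simp
  moreover have "prime (3::int)" by simp
  ultimately have "3 dvd (2::int) ^ i \<or> 3 dvd p ^ s" by (simp add: prime_dvd_mult_iff)
  then have "3 dvd (2::int) \<or> 3 dvd p" using \<open>prime (3::int)\<close> prime_dvd_power by blast
  with assms show False using primes_dvd_imp_eq[of 3 p] by auto
qed

lemma lead_eq_empty: "z \<le> 0 \<Longrightarrow> p > 0 \<Longrightarrow> lead p z = {}"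
proof -
  assume "z \<le> 0" "p > 0"
  then have "\<not> 2 ^ i * p ^ s < 3 * z" for i s :: nat
    by (smt (verit) mult_pos_pos zero_less_power)
  then show ?thesis by (simp add: lead_def)
qed

lemma finite_pow2_less: "finite {i. 2 ^ i < (p::int)}"
proof (rule finite_subset)
  show "{i. 2 ^ i < p} \<subseteq> {..<nat p}"
  proof
    fix i assume "i \<in> {i. 2 ^ i < p}"
    then have "int i < p" using order.strict_trans[OF of_nat_less_two_power] by blast
    then show "i \<in> {..<nat p}" by (simp add: zless_nat_eq_int_zless)
  qed
qed simp

lemma ex_power_between:
  fixes z :: int
  assumes "a \<ge> 2" "0 < c" "c < z"
  shows "\<exists>s. c * a ^ s < z \<and> z \<le> c * a ^ (s + 1)"
proof -
  have big: "z \<le> c * a ^ nat z"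
  proof -
    have "z < 2 ^ nat z" using of_nat_less_two_power[of "nat z", where ?'a = int] assms by simp
    also have "\<dots> \<le> a ^ nat z" using assms(1) by (intro power_mono) auto
    also have "\<dots> \<le> c * a ^ nat z" using assms(1,2) by simp
    finally show ?thesis by simp
  qed
  define k where "k = (LEAST s. z \<le> c * a ^ s)"
  have k: "z \<le> c * a ^ k" unfolding k_def using big by (rule LeastI)
  then have "k \<noteq> 0" using assms(3) by (intro notI) simp
  then obtain s where s: "k = Suc s" using not0_implies_Suc by blast
  have "\<not> z \<le> c * a ^ s" using not_less_Least[of s "\<lambda>s. z \<le> c * a ^ s"] s unfolding k_def by simp
  with k s show ?thesis by (auto simp: not_le)
qed

text \<open>Enclose \<open>3 * z\<close> between consecutive powers of \<open>p\<close>, then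
  between consecutive doublings of the lower one; the upper threshold is not attained, since 3 does
  not divide it.\<close>

lemma lead_ne_empty:
  assumes "prime p" "p > 3" "z > 0"
  shows "lead p z \<noteq> {}"
proof -
  have "1 < 3 * z" using assms(3) by linarith
  then obtain s where s: "p ^ s < 3 * z" "3 * z \<le> p ^ (s + 1)"
    using ex_power_between[of p 1 "3 * z"] assms(2) by auto
  obtain i where i: "p ^ s * 2 ^ i < 3 * z" "3 * z \<le> p ^ s * 2 ^ (i + 1)"
    using ex_power_between[of 2 "p ^ s" "3 * z"] assms(2) s(1) by auto
  have "p ^ s * 2 ^ i < p ^ s * p" using i(1) s(2) by (simp add: mult.commute)
  then have "2 ^ i < p" using assms by simp
  moreover have "3 * z < 2 ^ (i + 1) * p ^ s"
    using i(2) pow2_mult_power_neq_3_mult[OF assms(1,2), of "i + 1" s z] by (simp add: mult.commute)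
  ultimately have "i \<in> lead p z" using i(1) by (auto simp: lead_def mult.commute)
  then show ?thesis by blast
qed

text \<open>For \<open>r \<ge> 2\<close>, a shared index would put the quotient \<open>r\<close>
  strictly between \<open>p ^ k / 2\<close> and \<open>2 * p ^ k\<close> for some integer
  \<open>k\<close>, but \<open>2 \<le> r < p / 2\<close>. For negative \<open>r\<close> one of the
  two sets is empty.\<close>

lemma lead_mult_neq:
  assumes "prime p" "p > 3" "z > 0" "r \<noteq> 0" "r \<noteq> 1" "2 * \<bar>r\<bar> < p"
  shows "lead p (r * z) \<noteq> lead p z"
proof (cases "r < 0")
  case True
  then have "r * z \<le> 0" using assms(3) by (simp add: mult_nonpos_nonneg)
  then show ?thesis using lead_eq_empty[of "r * z" p] lead_ne_empty assms by auto
next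
  case False
  then have r: "r \<ge> 2" using assms by simp
  show ?thesis
  proof
    assume eq: "lead p (r * z) = lead p z"
    obtain i where i: "i \<in> lead p z" using lead_ne_empty assms by blast
    then obtain s where s: "2 ^ i * p ^ s < 3 * z" "3 * z < 2 ^ (i + 1) * p ^ s"
      by (auto simp: lead_def)
    from i eq have "i \<in> lead p (r * z)" by simp
    then obtain s' where s': "2 ^ i * p ^ s' < 3 * (r * z)" "3 * (r * z) < 2 ^ (i + 1) * p ^ s'"
      by (auto simp: lead_def)
    define E where "E = (2::int) ^ i"
    have E: "E > 0" by (simp add: E_def)
    have zr: "2 * (3 * z) \<le> 3 * (r * z)" using r assms(3) by simp
    show False
    proof (cases "s' \<le> s")
      case True
      then have "p ^ s' \<le> p ^ s" using assms(2) by (intro power_increasing) auto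
      then have "E * p ^ s' \<le> E * p ^ s" using E by simp
      moreover have "3 * z > E * p ^ s" "3 * z < 2 * (E * p ^ s)" "3 * (r * z) < 2 * (E * p ^ s')"
        using s s' by (simp_all add: E_def)
      ultimately show False using zr by linarith
    next
      case False
      then have "p ^ (s + 1) \<le> p ^ s'" using assms(2) by (intro power_increasing) auto
      then have "E * (p * p ^ s) \<le> E * p ^ s'" using E by simp
      also have "\<dots> < r * (3 * z)" using s' by (simp add: E_def algebra_simps)
      also have "\<dots> \<le> r * (2 * (E * p ^ s))" using s r by (simp add: E_def)
      finally have "p * (E * p ^ s) < (2 * r) * (E * p ^ s)" by (simp add: algebra_simps)
      moreover have "E * p ^ s > 0" using E assms(2) by simp
      ultimately have "p < 2 * r" by (simp only: mult_less_cancel_right_pos)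
      then show False using assms(6) r by simp
    qed
  qed
qed

text \<open>The integers \<open>c\<close> and \<open>3 * m\<close> differ by at least 1, so after
  scaling by \<open>q\<close> a shift by \<open>3 * x\<close> cannot bridge the gap.\<close>

lemma mult_less_perturb:
  fixes q :: int
  assumes "3 * \<bar>x\<bar> < q" "c \<noteq> 3 * m"
  shows "q * c < 3 * (x + q * m) \<longleftrightarrow> q * c < 3 * (q * m)"
    and "3 * (x + q * m) < q * c \<longleftrightarrow> 3 * (q * m) < q * c"
proof -
  define C M where "C = q * c" and "M = q * m"
  have q: "q > 0" using assms(1) by linarith
  have "c + 1 \<le> 3 * m \<or> 3 * m + 1 \<le> c" using assms(2) by linarith
  then have "q * (c + 1) \<le> q * (3 * m) \<or> q * (3 * m + 1) \<le> q * c"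
    using q by (auto intro: mult_left_mono)
  then have "C + q \<le> 3 * M \<or> 3 * M + q \<le> C"
    by (simp add: C_def M_def algebra_simps)
  moreover have "- q < 3 * x" "3 * x < q" using assms(1) by (simp_all add: abs_if split: if_splits)
  ultimately have "(C < 3 * (x + M) \<longleftrightarrow> C < 3 * M) \<and> (3 * (x + M) < C \<longleftrightarrow> 3 * M < C)"
    using q by auto
  then show "q * c < 3 * (x + q * m) \<longleftrightarrow> q * c < 3 * (q * m)"
    and "3 * (x + q * m) < q * c \<longleftrightarrow> 3 * (q * m) < q * c"
    unfolding C_def M_def by blast+
qed

lemma lead_add:
  assumes "prime p" "p > 3" "3 * \<bar>x\<bar> < p ^ T" "p ^ T dvd z" "z \<noteq> 0"
  shows "lead p (x + z) = lead p z"
proof -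
  have abs_z: "p ^ T \<le> \<bar>z\<bar>" using dvd_imp_le_int[OF assms(5,4)] assms(2) by simp
  show ?thesis
  proof (cases "z < 0")
    case True
    then have "x + z \<le> 0" using abs_z assms(3) by linarith
    then show ?thesis using True lead_eq_empty[of "x + z" p] lead_eq_empty[of z p] assms by simp
  next
    case False
    then have z: "p ^ T \<le> z" using abs_z by simp
    obtain m where m: "z = p ^ T * m" using assms(4) by blast
    have "(2 ^ i * p ^ s < 3 * (x + z) \<and> 3 * (x + z) < 2 ^ (i + 1) * p ^ s) \<longleftrightarrow>
       (2 ^ i * p ^ s < 3 * z \<and> 3 * z < 2 ^ (i + 1) * p ^ s)" if "2 ^ i < p" for i s
    proof (cases "T \<le> s")
      case True
      define k where "k = s - T"
      have ps: "p ^ s = p ^ T * p ^ k" using True by (simp add: k_def flip: power_add)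
      have eq: "2 ^ j * p ^ s = p ^ T * (2 ^ j * p ^ k)" for j by (simp add: ps)
      show ?thesis
        by (simp only: eq m mult_less_perturb[OF assms(3) pow2_mult_power_neq_3_mult[OF assms(1,2)]])
    next
      \<comment> \<open>The upper threshold is at most \<open>2 * p ^ T\<close>, while
        \<open>3 * z\<close> and \<open>3 * (x + z)\<close> are at least that, so both sides are
        false.\<close>
      case False
      then have "p ^ (s + 1) \<le> p ^ T" using assms(2) by (intro power_increasing) auto
      moreover have "2 ^ i * p ^ s \<le> p * p ^ s" using that assms(2) by (intro mult_right_mono) auto
      ultimately have "2 ^ (i + 1) * p ^ s \<le> 2 * p ^ T" by simp
      moreover have "0 < p ^ T" "- (p ^ T) < 3 * x"
        using assms(2,3) by (simp_all add: abs_if split: if_splits)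
      moreover have "D \<le> 3 * (x + z) \<and> D \<le> 3 * z"
        if "D \<le> 2 * q" "0 < q" "- q < 3 * x" "q \<le> z" for D q
        using that by auto
      ultimately have "2 ^ (i + 1) * p ^ s \<le> 3 * (x + z)" "2 ^ (i + 1) * p ^ s \<le> 3 * z"
        using z by blast+
      then show ?thesis by (simp add: not_less[symmetric])
    qed
    then show ?thesis unfolding lead_def by blast
  qed
qed

section \<open>Lowest nonzero digits and additivity of splittings\<close>

lemma not_dvd_digit: "0 < b \<Longrightarrow> b < p \<Longrightarrow> \<not> p dvd p * u + (b::int)"
  by (simp add: dvd_add_right_iff zdvd_not_zless)

lemma power_dvd_digit_iff:
  fixes p :: int
  assumes "prime p" "0 < b" "b < p"
  shows "p ^ T dvd p ^ t * (p * u + b) \<longleftrightarrow> T \<le> t"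
proof
  assume dvd: "p ^ T dvd p ^ t * (p * u + b)"
  show "T \<le> t"
  proof (rule ccontr)
    assume "\<not> T \<le> t"
    then have "p ^ (t + 1) dvd p ^ T" by (intro le_imp_power_dvd) simp
    then have "p ^ t * p dvd p ^ t * (p * u + b)" using dvd by (metis dvd_trans power_add power_one_right)
    then have "p dvd p * u + b" using assms by simp
    then show False using not_dvd_digit assms by blast
  qed
qed (simp add: le_imp_power_dvd dvd_mult2)

lemma abs_digit_ge:
  fixes p :: int
  assumes "0 < b" "b < p"
  shows "p ^ t \<le> \<bar>p ^ t * (p * u + b)\<bar>"
proof -
  have "p * u + b \<noteq> 0" using not_dvd_digit[OF assms, of u] by auto
  then have "1 \<le> \<bar>p * u + b\<bar>" by linarith
  then show ?thesis using assms by (simp add: abs_mult)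
qed

lemma finite_splits:
  assumes "0 < b" "b < p"
  shows "finite (splits p A b n)"
proof (rule finite_subset)
  show "splits p A b n \<subseteq> {- (2 * \<bar>n\<bar>)..2 * \<bar>n\<bar>}"
  proof
    fix y assume "y \<in> splits p A b n"
    then obtain t u where "y = p ^ t * (p * u + b)" "2 * \<bar>n - y\<bar> < p ^ t"
      unfolding splits_def by blast
    then have "2 * \<bar>n - y\<bar> < \<bar>y\<bar>" using abs_digit_ge[OF assms, of t u] by simp
    then show "y \<in> {- (2 * \<bar>n\<bar>)..2 * \<bar>n\<bar>}" by (auto simp: abs_if split: if_splits)
  qed
qed simp

lemma splits_0:
  assumes "0 < b" "b < p"
  shows "splits p A b 0 = {}"
proof -
  have "\<not> 2 * \<bar>0 - y\<bar> < p ^ t" if "y = p ^ t * (p * u + b)" for y t u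
    using abs_digit_ge[OF assms, of t u] that by simp
  then show ?thesis unfolding splits_def by blast
qed

lemma lowdig_unique:
  assumes "prime p" "0 < b" "b < p" "0 < b'" "b' < p" "lowdig p y b" "lowdig p y b'"
  shows "b = b'"
proof -
  obtain t u t' u' where y: "y = p ^ t * (p * u + b)" "y = p ^ t' * (p * u' + b')"
    using assms(6,7) unfolding lowdig_def by blast
  have "t \<le> t'" using power_dvd_digit_iff[OF assms(1,4,5), of t t' u'] y by (metis dvd_triv_left)
  moreover have "t' \<le> t" using power_dvd_digit_iff[OF assms(1-3), of t' t u] y by (metis dvd_triv_left)
  ultimately have "p * u + b = p * u' + b'" using y assms(2,3) by simp
  then have "(p * u + b) mod p = (p * u' + b') mod p" by simp
  then show ?thesis using assms by simp
qed

lemma ex_lowdig: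
  assumes "prime p" "y \<noteq> (0::int)"
  obtains b where "0 < b" "b < p" "lowdig p y b"
proof -
  have p: "p > 1" using assms(1) prime_gt_1_int by blast
  have "\<not> is_unit p" using assms(1) by auto
  then obtain w where w: "y = p ^ multiplicity p y * w" "\<not> p dvd w"
    using multiplicity_decompose'[of y p] assms(2) by metis
  have "w mod p \<noteq> 0" using w(2) by (simp add: dvd_eq_mod_eq_0)
  then have "0 < w mod p" "w mod p < p" using p by (simp_all add: pos_mod_sign le_neq_trans)
  moreover have "lowdig p y (w mod p)"
    unfolding lowdig_def using w(1) by (metis mult_div_mod_eq)
  ultimately show thesis using that by blast
qed

lemma lowdig_mult:
  assumes "lowdig p y b"
  shows "lowdig p (v * y) ((v * b) mod p)"
proof -
  obtain t u where "y = p ^ t * (p * u + b)" using assms by (auto simp: lowdig_def)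
  then have "v * y = p ^ t * (p * (v * u + (v * b) div p) + (v * b) mod p)"
    by (simp add: algebra_simps)
  then show ?thesis unfolding lowdig_def by blast
qed

text \<open>As \<open>\<bar>y\<bar>\<close> is at least \<open>p ^ t\<close> for the position
  \<open>t\<close> of its lowest nonzero digit, \<open>t < T\<close>, and \<open>z\<close> has only
  zeros there.\<close>

lemma lowdig_add:
  assumes "prime p" "0 < b" "b < p" "lowdig p y b" "\<bar>y\<bar> < p ^ T" "p ^ T dvd z"
  shows "lowdig p (y + z) b"
proof -
  obtain t u where y: "y = p ^ t * (p * u + b)" using assms(4) by (auto simp: lowdig_def)
  have "p ^ t < p ^ T" using abs_digit_ge[OF assms(2,3), of t u] assms(5) y by simp
  then have "t < T" using assms(2,3) by (simp add: power_strict_increasing_iff)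
  then have "p ^ (t + 1) dvd z" using assms(6) by (intro dvd_trans[OF le_imp_power_dvd[of "t + 1" T p]]) simp
  then obtain w where "z = p ^ (t + 1) * w" by blast
  then have "y + z = p ^ t * (p * (u + w) + b)" using y by (simp add: algebra_simps)
  then show ?thesis unfolding lowdig_def by blast
qed

text \<open>In balanced base \<open>p\<close> digits, \<open>X\<close> lies below position
  \<open>T\<close> and \<open>Y\<close> from \<open>T\<close> on. A cut of the sum falls inside
  \<open>X\<close>, or inside \<open>Y\<close>, where adding \<open>X\<close> to the lower part
  keeps its leading size, or at the junction \<open>y = Y\<close>. Divisibility by
  \<open>p ^ T\<close> separates the first kind from the others.\<close>

lemma splits_add:
  assumes p: "prime p" "p > 3" and b: "0 < b" "b < p"
    and X: "X \<noteq> 0" "3 * \<bar>X\<bar> < p ^ T" and Y: "Y \<noteq> 0" "p ^ T dvd Y"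
  shows "splits p A b (X + Y) = (\<lambda>y. y + Y) ` splits p A b X \<union> splits p A b Y \<union>
    {y. y = Y \<and> lead p X = A \<and> lowdig p Y b}"
    and "\<And>y. y \<in> splits p A b X \<Longrightarrow> \<not> p ^ T dvd y"
    and "\<And>y. y \<in> splits p A b Y \<Longrightarrow> p ^ T dvd y"
proof -
  have pos: "p ^ t > 0" for t using p(2) by simp
  have minus_small: "2 * \<bar>d\<bar> < k + q" if "2 * \<bar>X + d\<bar> < k" "3 * \<bar>X\<bar> < q" for d k q
    using that by (auto simp: abs_if split: if_splits)
  have plus_small: "2 * \<bar>X + d\<bar> < k" if "2 * \<bar>d\<bar> + q \<le> k" "3 * \<bar>X\<bar> < q" for d k q
    using that by (auto simp: abs_if split: if_splits)
  have p_mono: "p ^ T \<le> p ^ t" if "T \<le> t" for t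
    using that p(2) by (intro power_increasing) auto
  have low: "\<exists>w. Y = p ^ t * (p * w)" if "t < T" for t
  proof -
    have "p ^ (t + 1) dvd p ^ T" using that by (intro le_imp_power_dvd) simp
    then have "p ^ (t + 1) dvd Y" using Y(2) dvd_trans by blast
    then show ?thesis by (auto simp: dvd_def mult.assoc mult.left_commute)
  qed
  have high: "\<exists>m. Y - y = p ^ T * m" if "T \<le> t" "y = p ^ t * (p * u + b)" for t u y
    using Y(2) that power_dvd_digit_iff[OF p(1) b, of T t u] by (metis dvd_diff dvdE)
  have lt_X: "t < T" if "y = p ^ t * (p * u + b)" "2 * \<bar>X - y\<bar> < p ^ t" for t u y
  proof (rule ccontr)
    assume "\<not> t < T"
    then have "p ^ T \<le> p ^ t" using p_mono by simp
    moreover have "p ^ t \<le> \<bar>y\<bar>" using abs_digit_ge[OF b] that(1) by simp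
    ultimately show False using that(2) X(2) by (simp add: abs_if split: if_splits)
  qed
  have ge_Y: "T \<le> t" if "y = p ^ t * (p * u + b)" "2 * \<bar>Y - y\<bar> < p ^ t" for t u y
  proof (rule ccontr)
    assume "\<not> T \<le> t"
    then obtain w where w: "Y = p ^ t * (p * w)" using low[of t] by auto
    have "y - Y = p ^ t * (p * (u - w) + b)" using that(1) w by (simp add: algebra_simps)
    then have "p ^ t \<le> \<bar>y - Y\<bar>" using abs_digit_ge[OF b] by simp
    then show False using that(2) pos[of t] by (simp add: abs_minus_commute)
  qed
  show "\<not> p ^ T dvd y" if y: "y \<in> splits p A b X" for y
  proof -
    obtain t u where tu: "y = p ^ t * (p * u + b)" "2 * \<bar>X - y\<bar> < p ^ t"
      using y unfolding splits_def by blast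
    then show ?thesis using lt_X[OF tu] power_dvd_digit_iff[OF p(1) b, of T t u] by simp
  qed
  show "p ^ T dvd y" if y: "y \<in> splits p A b Y" for y
  proof -
    obtain t u where tu: "y = p ^ t * (p * u + b)" "2 * \<bar>Y - y\<bar> < p ^ t"
      using y unfolding splits_def by blast
    then show ?thesis using ge_Y[OF tu] power_dvd_digit_iff[OF p(1) b, of T t u] by simp
  qed
  show "splits p A b (X + Y) = (\<lambda>y. y + Y) ` splits p A b X \<union> splits p A b Y \<union>
    {y. y = Y \<and> lead p X = A \<and> lowdig p Y b}" (is "?L = ?R1 \<union> ?R2 \<union> ?R3")
  proof (intro equalityI subsetI)
    fix y assume "y \<in> ?L"
    then obtain t u where y: "y = p ^ t * (p * u + b)" "2 * \<bar>X + Y - y\<bar> < p ^ t"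
      and y': "y \<noteq> X + Y" "lead p (X + Y - y) = A" by (auto simp: splits_def)
    show "y \<in> ?R1 \<union> ?R2 \<union> ?R3"
    proof (cases "t < T")
      case True
      then obtain w where w: "Y = p ^ t * (p * w)" using low by blast
      have "y - Y = p ^ t * (p * (u - w) + b)" using y(1) w by (simp add: algebra_simps)
      moreover have "X - (y - Y) = X + Y - y" by simp
      ultimately have "y - Y \<in> splits p A b X"
        using y(2) y' by (intro splitsI[of _ p t "u - w"]) (simp_all add: algebra_simps)
      then have "y \<in> ?R1" by (intro image_eqI[of _ _ "y - Y"]) auto
      then show ?thesis by blast
    next
      case False
      then have T: "T \<le> t" by simp
      show ?thesis
      proof (cases "y = Y")
        case True
        then have "y \<in> ?R3" using y y' by (auto simp: lowdig_def)
        then show ?thesis by blast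
      next
        case False
        obtain m where m: "Y - y = p ^ T * m" using high[OF T y(1)] by blast
        define k where "k = p ^ (t - T)"
        have k: "p ^ t = p ^ T * k" using T by (simp add: k_def flip: power_add)
        \<comment> \<open>The size estimate only gives \<open>2 * \<bar>m\<bar> \<le> k\<close>;
          parity excludes equality, since \<open>p\<close> is odd.\<close>
        have "odd k" using p unfolding k_def by (simp add: prime_odd_int)
        have "2 * \<bar>Y - y\<bar> < p ^ t + p ^ T"
          using y(2) by (intro minus_small X(2)) (simp add: add_diff_eq)
        then have "p ^ T * (2 * \<bar>m\<bar>) < p ^ T * (k + 1)"
          using pos[of T] m k by (simp add: abs_mult algebra_simps)
        then have "2 * \<bar>m\<bar> < k + 1" using pos[of T] by (simp only: mult_less_cancel_left_pos)
        then have "2 * \<bar>m\<bar> \<le> k" using pos[of T] by simp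
        then have "2 * \<bar>m\<bar> < k" using \<open>odd k\<close> by (cases "2 * \<bar>m\<bar> = k") auto
        then have "p ^ T * (2 * \<bar>m\<bar>) < p ^ T * k" using pos[of T] by simp
        then have "2 * \<bar>Y - y\<bar> < p ^ t" using m k pos[of T] by (simp add: abs_mult algebra_simps)
        moreover have "lead p (X + (Y - y)) = lead p (Y - y)"
          by (rule lead_add[OF p X(2)]) (use m False p(2) in auto)
        ultimately have "y \<in> ?R2"
          using y'(2) False by (intro splitsI[OF y(1)]) (simp_all add: add_diff_eq)
        then show ?thesis by blast
      qed
    qed
  next
    fix y assume "y \<in> ?R1 \<union> ?R2 \<union> ?R3"
    then consider "y \<in> ?R1" | "y \<in> ?R2" | "y \<in> ?R3" by blast
    then show "y \<in> ?L"
    proof cases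
      case 1
      then obtain y0 where y0: "y = y0 + Y" "y0 \<in> splits p A b X" by blast
      then obtain t u where tu: "y0 = p ^ t * (p * u + b)" "2 * \<bar>X - y0\<bar> < p ^ t"
        by (auto simp: splits_def)
      obtain w where w: "Y = p ^ t * (p * w)" using low[OF lt_X[OF tu]] by blast
      have y: "y = p ^ t * (p * (u + w) + b)" using tu(1) w y0(1) by (simp add: algebra_simps)
      have eq: "X + Y - y = X - y0" using y0(1) by simp
      have "y0 \<noteq> X" "lead p (X - y0) = A" using y0(2) by (simp_all add: splits_def)
      then show ?thesis
        using tu(2) eq y0(1) by (intro splitsI[OF y]) simp_all
    next
      case 2
      then obtain t u where tu: "y = p ^ t * (p * u + b)" "2 * \<bar>Y - y\<bar> < p ^ t"
        and y: "y \<noteq> Y" "lead p (Y - y) = A"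
        by (auto simp: splits_def)
      note T = ge_Y[OF tu]
      obtain m where m: "Y - y = p ^ T * m" using high[OF T tu(1)] by blast
      define k where "k = p ^ (t - T)"
      have k: "p ^ t = p ^ T * k" using T by (simp add: k_def flip: power_add)
      have "m \<noteq> 0" using m y(1) by auto
      then have "p ^ T * 1 \<le> p ^ T * \<bar>m\<bar>" using pos[of T] by (intro mult_left_mono) auto
      then have big: "p ^ T \<le> \<bar>Y - y\<bar>" using m pos[of T] by (simp add: abs_mult)
      \<comment> \<open>Strict inequality between integers leaves room for a whole
        \<open>p ^ T\<close>, enough to add \<open>X\<close>.\<close>
      have "p ^ T * (2 * \<bar>m\<bar>) < p ^ T * k"
        using tu(2) m k pos[of T] by (simp add: abs_mult algebra_simps)
      then have "2 * \<bar>m\<bar> + 1 \<le> k" using pos[of T] by simp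
      then have "p ^ T * (2 * \<bar>m\<bar> + 1) \<le> p ^ T * k" using pos[of T] by simp
      then have "2 * \<bar>Y - y\<bar> + p ^ T \<le> p ^ t"
        using m k pos[of T] by (simp add: abs_mult algebra_simps)
      then have "2 * \<bar>X + Y - y\<bar> < p ^ t"
        using plus_small[OF _ X(2), of "Y - y" "p ^ t"] by (simp add: add_diff_eq)
      moreover have "lead p (X + (Y - y)) = lead p (Y - y)"
        by (rule lead_add[OF p X(2)]) (use m y p(2) in auto)
      moreover have "y \<noteq> X + Y" using big X(2) by auto
      ultimately show ?thesis
        using y(2) by (intro splitsI[OF tu(1)]) (simp_all add: add_diff_eq)
    next
      case 3
      then obtain t u where tu: "Y = p ^ t * (p * u + b)" and y: "y = Y" "lead p X = A"
        by (auto simp: lowdig_def)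
      have "T \<le> t" using Y(2) tu power_dvd_digit_iff[OF p(1) b] by blast
      then have "2 * \<bar>X\<bar> < p ^ t" using plus_small[OF _ X(2), of 0 "p ^ t"] p_mono[of t] by simp
      with tu y X(1) show ?thesis by (intro splitsI[of y p t u]) simp_all
    qed
  qed
qed

text \<open>The union is disjoint: shifted cuts of \<open>X\<close> are not multiples of
  \<open>p ^ T\<close>, and \<open>Y\<close> is no cut of itself because remainders are
  nonzero.\<close>

lemma card_splits_add:
  assumes p: "prime p" "p > 3" and b: "0 < b" "b < p"
    and X: "X \<noteq> 0" "3 * \<bar>X\<bar> < p ^ T" and Y: "Y \<noteq> 0" "p ^ T dvd Y"
  shows "card (splits p A b (X + Y)) = card (splits p A b X) + card (splits p A b Y) +
    of_bool (lead p X = A \<and> lowdig p Y b)"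
proof -
  note S = splits_add[OF assms]
  let ?R1 = "(\<lambda>y. y + Y) ` splits p A b X" and ?R3 = "{y. y = Y \<and> lead p X = A \<and> lowdig p Y b}"
  have R1: "\<not> p ^ T dvd y" if "y \<in> ?R1" for y
    using that S(2) Y(2) by (auto simp: dvd_add_left_iff)
  have "?R1 \<inter> splits p A b Y = {}" using R1 S(3) by blast
  moreover have "(?R1 \<union> splits p A b Y) \<inter> ?R3 = {}"
    using R1 Y(2) by (auto simp: splits_def)
  moreover have "finite ?R3" by simp
  ultimately have "card (splits p A b (X + Y)) = card ?R1 + card (splits p A b Y) + card ?R3"
    unfolding S(1) using finite_splits[OF b] by (simp add: card_Un_disjoint)
  moreover have "card ?R1 = card (splits p A b X)" by (rule card_image) (simp add: inj_on_def)
  moreover have "card ?R3 = of_bool (lead p X = A \<and> lowdig p Y b)"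
    by (cases "lead p X = A \<and> lowdig p Y b") simp_all
  ultimately show ?thesis by simp
qed

section \<open>The colouring that excludes further rows\<close>

text \<open>The last two components are graphs of functions on finite index sets, which keeps the
  range finite. For prime \<open>p\<close> and \<open>n \<noteq> 0\<close> the first one is a
  singleton.\<close>

definition profile :: "int \<Rightarrow> nat \<Rightarrow> int set \<Rightarrow> int \<Rightarrow>
    int set \<times> (int \<times> nat set) set \<times> (int \<times> nat set \<times> int \<times> nat) set" where
  "profile p q V n =
    ({b. 0 < b \<and> b < p \<and> lowdig p n b},
     {(v, A). v \<in> V \<and> lead p (v * n) = A},
     {(v, A, b, m). v \<in> V \<and> A \<subseteq> {i. 2 ^ i < p} \<and> 0 < b \<and> b < p \<and>
        m = card (splits p A b (v * n)) mod q})"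

lemma lead_subset: "lead p z \<subseteq> {i. 2 ^ i < p}"
  by (auto simp: lead_def)

lemma finite_range_profile:
  assumes "finite V" "q > 0"
  shows "finite (range (profile p q V))"
proof (rule finite_subset)
  let ?I = "Pow {i. 2 ^ i < p}"
  show "range (profile p q V) \<subseteq> Pow {0..p} \<times> Pow (V \<times> ?I) \<times> Pow (V \<times> ?I \<times> {0..p} \<times> {..<q})"
    using assms(2) by (auto simp: profile_def dest: subsetD[OF lead_subset])
  show "finite (Pow {0..p} \<times> Pow (V \<times> ?I) \<times> Pow (V \<times> ?I \<times> {0..p} \<times> {..<q}))"
    using assms(1) finite_pow2_less by simp
qed

lemma profile_eqD:
  assumes "profile p q V m = profile p q V n"
  shows "0 < b \<Longrightarrow> b < p \<Longrightarrow> lowdig p m b \<longleftrightarrow> lowdig p n b"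
    and "v \<in> V \<Longrightarrow> lead p (v * m) = lead p (v * n)"
    and "v \<in> V \<Longrightarrow> A \<subseteq> {i. 2 ^ i < p} \<Longrightarrow> 0 < b \<Longrightarrow> b < p \<Longrightarrow>
      card (splits p A b (v * m)) mod q = card (splits p A b (v * n)) mod q"
proof -
  have 1: "{b. 0 < b \<and> b < p \<and> lowdig p m b} = {b. 0 < b \<and> b < p \<and> lowdig p n b}"
    and 2: "{(v, A). v \<in> V \<and> lead p (v * m) = A} = {(v, A). v \<in> V \<and> lead p (v * n) = A}"
    and 3: "{(v, A, b, k). v \<in> V \<and> A \<subseteq> {i. 2 ^ i < p} \<and> 0 < b \<and> b < p \<and>
        k = card (splits p A b (v * m)) mod q} =
      {(v, A, b, k). v \<in> V \<and> A \<subseteq> {i. 2 ^ i < p} \<and> 0 < b \<and> b < p \<and>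
        k = card (splits p A b (v * n)) mod q}"
    using assms unfolding profile_def by simp_all
  show "lowdig p m b \<longleftrightarrow> lowdig p n b" if "0 < b" "b < p"
    using 1 that by blast
  show "lead p (v * m) = lead p (v * n)" if "v \<in> V"
  proof -
    have "(v, lead p (v * m)) \<in> {(v, A). v \<in> V \<and> lead p (v * m) = A}" using that by simp
    then show ?thesis unfolding 2 by simp
  qed
  show "card (splits p A b (v * m)) mod q = card (splits p A b (v * n)) mod q"
    if "v \<in> V" "A \<subseteq> {i. 2 ^ i < p}" "0 < b" "b < p"
  proof -
    have "(v, A, b, card (splits p A b (v * m)) mod q) \<in>
      {(v, A, b, k). v \<in> V \<and> A \<subseteq> {i. 2 ^ i < p} \<and> 0 < b \<and> b < p \<and>
        k = card (splits p A b (v * m)) mod q}" using that by simp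
    then show ?thesis unfolding 3 by simp
  qed
qed

lemma ex_nat_colouring:
  fixes K :: "nat \<Rightarrow> 'a"
  assumes "finite (range K)"
  obtains c :: "nat \<Rightarrow> nat" where "finite (range c)" "\<forall>m n. c m = c n \<longrightarrow> K m = K n"
proof -
  obtain f :: "'a \<Rightarrow> nat" where "inj_on f (range K)"
    using finite_imp_inj_to_nat_seg[OF assms] by blast
  then have "f (K m) = f (K n) \<Longrightarrow> K m = K n" for m n by (auto simp: inj_on_def)
  moreover have "finite (range (\<lambda>n. f (K n)))"
    using finite_imageI[OF assms, of f] by (simp add: image_image)
  ultimately show thesis using that[of "\<lambda>n. f (K n)"] by blast
qed

text \<open>Rapid growth enters through \<open>gap\<close>, which yields the separation that
  \<open>card_splits_add\<close> requires for coefficients up to \<open>R\<close>. The bound on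
  \<open>p\<close> makes nonzero integers of size at most \<open>R + 1\<close> prime to
  \<open>p\<close> and lets \<open>lead_mult_neq\<close> apply.\<close>

lemma no_row_with_same_profile:
  fixes p R :: int and r X :: "nat \<Rightarrow> int"
  assumes p: "prime p" "p > 6 * R"
    and R: "R \<ge> 1" "(\<Sum>j<N. \<bar>r j\<bar>) \<le> R"
    and X: "\<And>j. X j \<ge> 1"
    and gap: "\<And>i. \<exists>T. 3 * R * X i < p ^ T \<and> (\<forall>j>i. p ^ T dvd X j)"
    and prof: "\<And>S. \<lbrakk>finite S; S \<noteq> {}\<rbrakk> \<Longrightarrow> profile p (N + 1) (insert 1 (r ` {..<N})) (\<Sum>j\<in>S. X j) = \<kappa>"
    and prof_r: "profile p (N + 1) (insert 1 (r ` {..<N})) (\<Sum>j<N. r j * X j) = \<kappa>"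
    and r: "\<exists>j<N. r j \<notin> {0, 1}"
  shows False
proof -
  define V where "V = insert 1 (r ` {..<N})"
  define Q where "Q i = (\<Sum>j<i. r j * X j)" for i
  define q where "q = N + 1"
  have p3: "p > 3" using p(2) R(1) by simp
  have r_le: "\<bar>r j\<bar> \<le> R" if "j < N" for j
    using member_le_sum[of j "{..<N}" "\<lambda>j. \<bar>r j\<bar>"] that R(2) by simp
  have V_le: "\<bar>v\<bar> \<le> R" if "v \<in> V" for v
    using that R(1) unfolding V_def by (elim insertE imageE) (simp_all add: r_le)
  have X_mono: "X i \<le> X j" if "i < j" for i j
  proof -
    obtain T where T: "3 * R * X i < p ^ T" "\<forall>j>i. p ^ T dvd X j"
      using gap[of i] by (elim exE conjE)
    have "p ^ T \<le> X j" using T(2)[rule_format, OF that] X[of j] by (intro zdvd_imp_le) simp_all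
    moreover have "1 * X i \<le> (3 * R) * X i" using R(1) X[of i] by (intro mult_right_mono) auto
    ultimately show ?thesis using T(1) by simp
  qed
  have small: "3 * \<bar>v * X i\<bar> < p ^ T" if "\<bar>v\<bar> \<le> R" "3 * R * X i < p ^ T" for v i T
  proof -
    have "\<bar>v\<bar> * X i \<le> R * X i" using that(1) X[of i] by (intro mult_right_mono) auto
    moreover have "\<bar>v * X i\<bar> = \<bar>v\<bar> * X i" using X[of i] by (simp add: abs_mult)
    ultimately show ?thesis using that(2) by linarith
  qed
  have Q_small: "\<exists>T. 3 * \<bar>Q i\<bar> < p ^ T \<and> p ^ T dvd X i" if "i \<le> N" for i
  proof (cases i)
    case 0
    then show ?thesis by (intro exI[of _ 0]) (simp add: Q_def)
  next
    case (Suc k)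
    \<comment> \<open>All \<open>X j\<close> involved are at most \<open>X k\<close>, so
      \<open>\<bar>Q i\<bar> \<le> R * X k\<close>, and the gap after \<open>k\<close> separates it
      from \<open>X i\<close>.\<close>
    have "\<bar>Q i\<bar> \<le> (\<Sum>j<i. \<bar>r j * X j\<bar>)" unfolding Q_def by (rule sum_abs)
    also have "\<dots> \<le> (\<Sum>j<i. \<bar>r j\<bar> * X k)"
    proof (rule sum_mono)
      fix j assume "j \<in> {..<i}"
      then have "X j \<le> X k" using X_mono[of j k] Suc by (cases "j = k") auto
      then show "\<bar>r j * X j\<bar> \<le> \<bar>r j\<bar> * X k"
        using X[of j] by (simp add: abs_mult mult_left_mono)
    qed
    also have "\<dots> = (\<Sum>j<i. \<bar>r j\<bar>) * X k" by (simp add: sum_distrib_right)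
    also have "\<dots> \<le> (\<Sum>j<N. \<bar>r j\<bar>) * X k"
      using that X[of k] by (intro mult_right_mono sum_mono2) auto
    also have "\<dots> \<le> R * X k" using R(2) X[of k] by (intro mult_right_mono) auto
    finally have "3 * \<bar>Q i\<bar> \<le> 3 * R * X k" by simp
    moreover obtain T where "3 * R * X k < p ^ T" "\<forall>j>k. p ^ T dvd X j" using gap[of k] by (elim exE conjE)
    ultimately show ?thesis using Suc by (intro exI[of _ T]) auto
  qed
  have prof: "profile p q V (\<Sum>j\<in>S. X j) = profile p q V (X 0)" if "finite S" "S \<noteq> {}" for S
    using prof[OF that] prof[of "{0}"] unfolding V_def q_def by simp
  then have profX: "profile p q V (X j) = profile p q V (X 0)" for j
    using prof[of "{j}"] by simp
  have profQ: "profile p q V (Q N) = profile p q V (X 0)"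
    using prof_r assms(7)[of "{0}"] unfolding V_def q_def Q_def by simp
  have V1: "1 \<in> V" by (simp add: V_def)
  obtain b0 where b0: "0 < b0" "b0 < p" "lowdig p (X 0) b0"
    using ex_lowdig[OF p(1), of "X 0"] X[of 0] by auto
  have low_X: "lowdig p (X j) b0" for j
    using profile_eqD(1)[OF profX b0(1,2)] b0(3) by blast
  \<comment> \<open>The cut between the first bad summand \<open>r m * X m\<close> and the sum before it has the type \<open>(A, b)\<close>
    below; no \<open>v * (X i + X j)\<close> with \<open>v \<in> V\<close> contributes such a cut.\<close>
  define m where "m = (LEAST j. r j \<notin> {0, 1})"
  have m: "r m \<notin> {0, 1}" "\<And>j. j < m \<Longrightarrow> r j \<in> {0, 1}"
    using r not_less_Least[of _ "\<lambda>j. r j \<notin> {0, 1}"] LeastI_ex[of "\<lambda>j. r j \<notin> {0, 1}"]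
    unfolding m_def by blast+
  have mN: "m < N" using r m(2) by (meson not_less order.strict_trans1 linorder_neqE_nat)
  have "r m \<in> V" using mN by (simp add: V_def)
  have p_ndvd: "\<not> p dvd v" if "v \<noteq> 0" "\<bar>v\<bar> \<le> R + 1" for v
    using dvd_imp_le_int[OF that(1), of p] that(2) p(2) R(1) by linarith
  \<comment> \<open>The lowest nonzero digit of \<open>r m * X m\<close>. It is nonzero and differs
    from \<open>b0\<close> because \<open>p\<close> divides neither \<open>r m\<close> nor
    \<open>r m - 1\<close>.\<close>
  define b where "b = (r m * b0) mod p"
  have "\<not> p dvd b0" using b0(1,2) zdvd_not_zless by blast
  then have "\<not> p dvd r m * b0"
    using p(1) p_ndvd[of "r m"] V_le[OF \<open>r m \<in> V\<close>] m(1) by (auto simp: prime_dvd_mult_iff)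
  then have "b \<noteq> 0" unfolding b_def by (simp add: dvd_eq_mod_eq_0)
  moreover have "0 \<le> b" "b < p" using p3 unfolding b_def by simp_all
  ultimately have b: "0 < b" "b < p" by simp_all
  have "b \<noteq> b0"
  proof
    assume "b = b0"
    then have "(r m * b0) mod p = b0 mod p" using b0(1,2) by (simp add: b_def)
    then have "p dvd (r m - 1) * b0" by (simp add: mod_eq_dvd_iff algebra_simps)
    then have "p dvd r m - 1" using p(1) \<open>\<not> p dvd b0\<close> by (simp add: prime_dvd_mult_iff)
    moreover have "\<bar>r m - 1\<bar> \<le> R + 1" using V_le[OF \<open>r m \<in> V\<close>] by linarith
    ultimately show False using p_ndvd[of "r m - 1"] m(1) by simp
  qed
  then have not_low_X: "\<not> lowdig p (X j) b" for j
    using lowdig_unique[OF p(1) b b0(1,2)] low_X by blast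
  have low_m: "lowdig p (r m * X m) b" unfolding b_def by (rule lowdig_mult[OF low_X])
  define A where "A = lead p (X 0)"
  have A: "A \<subseteq> {i. 2 ^ i < p}" unfolding A_def by (rule lead_subset)
  have lead_X: "lead p (X j) = A" for j
    using profile_eqD(2)[OF profX V1, of j] by (simp add: A_def)
  \<comment> \<open>For \<open>v = 1\<close> the digit is \<open>b0\<close> rather than
    \<open>b\<close>; any other \<open>v\<close> changes the leading size.\<close>
  have no_split: "\<not> (lead p (v * X i) = A \<and> lowdig p (v * X j) b)" if "v \<in> V" "v \<noteq> 0" for v i j
  proof (cases "v = 1")
    case True
    then show ?thesis using not_low_X by simp
  next
    case False
    then have "lead p (v * X i) \<noteq> lead p (X i)"
      using p(2) p3 X[of i] that V_le[OF that(1)] R(1) by (intro lead_mult_neq p(1)) auto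
    then show ?thesis using lead_X by simp
  qed
  let ?C = "\<lambda>n. card (splits p A b n)"
  \<comment> \<open>Apply additivity to \<open>v * (X i + X (i + 1))\<close>, whose parts all have the same count modulo \<open>q\<close>.\<close>
  have mult_X: "?C (v * X i) mod q = 0" if v: "v \<in> V" "v \<noteq> 0" for v i
  proof -
    obtain T where T: "3 * R * X i < p ^ T" "\<forall>j>i. p ^ T dvd X j"
      using gap[of i] by (elim exE conjE)
    have "?C (v * X i + v * X (i + 1)) = ?C (v * X i) + ?C (v * X (i + 1)) +
      of_bool (lead p (v * X i) = A \<and> lowdig p (v * X (i + 1)) b)"
      using v X[of i] X[of "i + 1"] T small[OF V_le[OF v(1)] T(1)]
      by (intro card_splits_add[OF p(1) p3 b, where T = T]) auto
    then have sum: "?C (v * (X i + X (i + 1))) = ?C (v * X i) + ?C (v * X (i + 1))"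
      using no_split[OF v] by (simp add: distrib_left)
    have "?C (v * (X i + X (i + 1))) mod q = ?C (v * X 0) mod q"
      using profile_eqD(3)[OF prof[of "{i, i + 1}"] v(1) A b] by simp
    moreover have "?C (v * X j) mod q = ?C (v * X 0) mod q" for j
      by (rule profile_eqD(3)[OF profX v(1) A b])
    ultimately have "(?C (v * X 0) + ?C (v * X 0)) mod q = ?C (v * X 0) mod q"
      unfolding sum by (metis mod_add_cong)
    then have "?C (v * X 0) mod q = 0"
      by (simp add: mod_eq_dvd_iff_nat dvd_eq_mod_eq_0)
    then show ?thesis using profile_eqD(3)[OF profX v(1) A b, of i] by simp
  qed
  have Q_Suc: "Q (Suc i) = Q i + r i * X i" for i by (simp add: Q_def)
  \<comment> \<open>A hit is a junction with label \<open>(A, b)\<close> where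
    \<open>r i * X i\<close> joins a nonzero partial sum. Each summand alone counts 0 modulo
    \<open>q\<close>, so only hits matter.\<close>
  define hit where "hit i \<longleftrightarrow> r i \<noteq> 0 \<and> Q i \<noteq> 0 \<and> lead p (Q i) = A \<and> lowdig p (r i * X i) b" for i
  have C_Suc: "?C (Q (Suc i)) mod q = (?C (Q i) + of_bool (hit i)) mod q" if i: "i < N" for i
  proof (cases "r i = 0")
    case True
    then show ?thesis by (simp add: Q_Suc hit_def)
  next
    case False
    have V: "r i \<in> V" using i by (simp add: V_def)
    show ?thesis
    proof (cases "Q i = 0")
      case True
      then show ?thesis using mult_X[OF V False] splits_0[OF b] by (simp add: Q_Suc hit_def)
    next
      case Q: False
      obtain T where T: "3 * \<bar>Q i\<bar> < p ^ T" "p ^ T dvd X i" using Q_small[of i] i by auto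
      have "?C (Q i + r i * X i) = ?C (Q i) + ?C (r i * X i) +
        of_bool (lead p (Q i) = A \<and> lowdig p (r i * X i) b)"
        using False Q T X[of i] by (intro card_splits_add[OF p(1) p3 b, where T = T]) auto
      then have "?C (Q (Suc i)) = ?C (Q i) + of_bool (hit i) + ?C (r i * X i)"
        using False Q by (simp add: Q_Suc hit_def)
      then show ?thesis using mult_X[OF V False, of i] by (metis add.right_neutral mod_add_right_eq)
    qed
  qed
  have C_Q: "?C (Q i) mod q = (\<Sum>j<i. of_bool (hit j)) mod q" if "i \<le> N" for i
    using that
  proof (induction i)
    case 0
    then show ?case using splits_0[OF b] by (simp add: Q_def)
  next
    case (Suc i)
    then have "?C (Q (Suc i)) mod q = ((\<Sum>j<i. of_bool (hit j)) + of_bool (hit i)) mod q"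
      using C_Suc[of i] by (intro trans[OF C_Suc mod_add_cong]) simp_all
    then show ?case by simp
  qed
  have "?C (Q N) mod q = 0"
    using profile_eqD(3)[OF profQ V1 A b] mult_X[OF V1, of 0] by simp
  then have "(\<Sum>j<N. of_bool (hit j)) mod q = 0" using C_Q[of N] by simp
  \<comment> \<open>There are at most \<open>N < q\<close> hits, so vanishing modulo
    \<open>q\<close> means that there are none.\<close>
  moreover have "(\<Sum>j<N. of_bool (hit j)) \<le> (\<Sum>j<N. 1::nat)" by (rule sum_mono) simp
  then have "(\<Sum>j<N. of_bool (hit j)) < q" by (simp add: q_def)
  ultimately have "(\<Sum>j<N. of_bool (hit j)) = (0::nat)" by (metis mod_less)
  then have no_hit: "\<not> hit j" if "j < N" for j
    using that by (auto simp: sum_eq_0_iff)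
  \<comment> \<open>Before \<open>m\<close> all coefficients are 0 or 1, so \<open>Q m\<close> is a
    finite sum of the \<open>X j\<close> and, if \<open>S\<close> is nonempty, has leading size
    \<open>A\<close>.\<close>
  define S where "S = {j. j < m \<and> r j = 1}"
  have Q_m: "Q m = (\<Sum>j\<in>S. X j)"
  proof -
    have "Q m = (\<Sum>j<m. if r j = 1 then X j else 0)"
      unfolding Q_def using m(2) by (intro sum.cong) auto
    also have "\<dots> = (\<Sum>j\<in>S. X j)" by (simp add: sum.inter_filter[symmetric] S_def)
    finally show ?thesis .
  qed
  show False
  proof (cases "S = {}")
    case False
    have fin: "finite S" by (simp add: S_def)
    have "lead p (Q m) = A"
      using profile_eqD(2)[OF prof[OF fin False] V1] by (simp add: Q_m A_def)
    moreover have "Q m > 0"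
      unfolding Q_m using fin False order.strict_trans2[OF zero_less_one X] by (intro sum_pos)
    ultimately have "hit m" using m(1) low_m by (simp add: hit_def)
    then show False using no_hit mN by blast
  next
    \<comment> \<open>Now \<open>r m * X m\<close> is the lowest summand and makes \<open>b\<close>
      the lowest nonzero digit, whereas the profile demands \<open>b0\<close>.\<close>
    case True
    obtain T where T: "3 * R * X m < p ^ T" "\<forall>j>m. p ^ T dvd X j" using gap[of m] by (elim exE conjE)
    have "Q N = Q (Suc m) + (\<Sum>j\<in>{Suc m..<N}. r j * X j)"
      unfolding Q_def lessThan_atLeast0 using mN by (intro sum.atLeastLessThan_concat[symmetric]) auto
    also have "Q (Suc m) = r m * X m" using True Q_m by (simp add: Q_Suc)
    finally have Q_N: "Q N = r m * X m + (\<Sum>j\<in>{Suc m..<N}. r j * X j)" .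
    have "lowdig p (Q N) b"
      unfolding Q_N
    proof (rule lowdig_add[OF p(1) b low_m])
      show "\<bar>r m * X m\<bar> < p ^ T"
        using small[OF V_le[OF \<open>r m \<in> V\<close>] T(1)] by linarith
      show "p ^ T dvd (\<Sum>j = Suc m..<N. r j * X j)"
        using T(2) by (intro dvd_sum) auto
    qed
    moreover have "lowdig p (Q N) b0" using profile_eqD(1)[OF profQ b0(1,2)] b0(3) by blast
    ultimately show False
      using lowdig_unique[OF p(1) b b0(1,2)] \<open>b \<noteq> b0\<close> by blast
  qed
qed

section \<open>Application to the adjoined row\<close>

lemma not_rapidly_ipr_adjoin_row:
  fixes r :: "nat \<Rightarrow> int"
  assumes fin: "finite {j. r j \<noteq> 0}" and not_row: "\<forall>i. r \<noteq> finite_sums_matrix i"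
  shows "\<not> rapidly_ipr \<infinity> \<infinity> (\<lambda>i j. rat_of_int (adjoin_row r finite_sums_matrix i j))"
proof
  assume rapid: "rapidly_ipr \<infinity> \<infinity> (\<lambda>i j. rat_of_int (adjoin_row r finite_sums_matrix i j))"
  obtain N where N: "\<And>j. r j \<noteq> 0 \<Longrightarrow> j < N"
    using fin by (auto simp: finite_nat_set_iff_bounded)
  define R where "R = 1 + (\<Sum>j<N. \<bar>r j\<bar>)"
  have R: "R \<ge> 1" unfolding R_def by (simp add: sum_nonneg)
  obtain p :: nat where p: "prime p" "nat (6 * R) < p" using bigger_prime by blast
  define V where "V = insert 1 (r ` {..<N})"
  have "finite (range (\<lambda>n. profile (int p) (N + 1) V (int n)))"
    by (rule finite_subset[OF _ finite_range_profile[of V "N + 1" "int p"]]) (auto simp: V_def)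
  then obtain c :: "nat \<Rightarrow> nat" where c: "finite (range c)" "\<forall>m n. c m = c n \<longrightarrow>
    profile (int p) (N + 1) V (int m) = profile (int p) (N + 1) V (int n)"
    by (rule ex_nat_colouring)
  have "finite (c ` {1..})" by (rule finite_subset[OF _ c(1)]) auto
  with p(1) have "finite (c ` {1..}) \<and> prime p" by blast
  from rapid[unfolded rapidly_ipr_def, rule_format, OF this]
  obtain x :: "nat \<Rightarrow> nat" and a where x: "\<And>j. 1 \<le> x j"
    and mono: "\<And>i. \<exists>n\<ge>1. mat_entry \<infinity> (\<lambda>i j. rat_of_int (adjoin_row r finite_sums_matrix i j)) x i
      = of_nat n \<and> c n = a"
    and step: "\<And>i s. p ^ s \<le> x i \<Longrightarrow> p ^ (s + 8) dvd x (i + 1)"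
    by auto
  have p2: "p \<ge> 2" using p(1) by (rule prime_ge_2_nat)
  have sums: "c (\<Sum>j\<in>S. x j) = a" if S: "finite S" "S \<noteq> {}" for S
  proof -
    obtain i where i: "\<And>j. bit (Suc i) j \<longleftrightarrow> j \<in> S" using ex_row_of_set[OF S] by blast
    have "mat_entry \<infinity> (\<lambda>i j. rat_of_int (adjoin_row r finite_sums_matrix i j)) x (Suc i) =
      of_nat (\<Sum>j\<in>S. x j)"
      by (simp add: mat_entry_def adjoin_row_def finite_sums_matrix_eq i)
    then show ?thesis using mono[of "Suc i"] by (metis of_nat_eq_iff)
  qed
  obtain n where n: "n \<ge> 1" "c n = a"
    and "mat_entry \<infinity> (\<lambda>i j. rat_of_int (adjoin_row r finite_sums_matrix i j)) x 0 = of_nat n"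
    using mono by blast
  then have "rat_of_int (\<Sum>j | r j \<noteq> 0. r j * int (x j)) = rat_of_int (int n)"
    by (simp add: mat_entry_def adjoin_row_def)
  then have "(\<Sum>j | r j \<noteq> 0. r j * int (x j)) = int n" by (simp only: of_int_eq_iff)
  moreover have "(\<Sum>j | r j \<noteq> 0. r j * int (x j)) = (\<Sum>j<N. r j * int (x j))"
    by (rule sum.mono_neutral_left) (use N in auto)
  ultimately have row: "(\<Sum>j<N. r j * int (x j)) = int n" by simp
  \<comment> \<open>With entries in \<open>{0, 1}\<close> only, \<open>r\<close> would be a row of
    the matrix; it is nonzero because its value \<open>n\<close> is positive.\<close>
  have "\<exists>j<N. r j \<notin> {0, 1}"
  proof (rule ccontr)
    assume "\<not> ?thesis"
    then have r01: "r j \<in> {0, 1}" for j using N[of j] by blast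
    define S where "S = {j. r j = 1}"
    have "finite S" unfolding S_def by (rule finite_subset[OF _ fin]) auto
    moreover have "S \<noteq> {}"
    proof
      assume "S = {}"
      then have "r j = 0" for j using r01[of j] by (auto simp: S_def)
      then show False using row n(1) by simp
    qed
    ultimately obtain i where i: "\<And>j. bit (Suc i) j \<longleftrightarrow> j \<in> S" using ex_row_of_set by blast
    have "r j = finite_sums_matrix i j" for j
      using r01[of j] i[of j] by (auto simp: finite_sums_matrix_eq S_def)
    then show False using not_row by blast
  qed
  moreover have "\<exists>T. 3 * R * int (x i) < int p ^ T \<and> (\<forall>j>i. int p ^ T dvd int (x j))" for i
  proof -
    obtain s where s: "p ^ s \<le> x i" "x i < p ^ (s + 1)"
      using ex_power_ivl1[OF p2 x] by blast
    \<comment> \<open>Divisibility propagates: a positive multiple of \<open>p ^ (s + 8)\<close> is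
      at least that large, so \<open>step\<close> applies again.\<close>
    have dvd: "p ^ (s + 8) dvd x j" if "i < j" for j
      using that
    proof (induction j)
      case (Suc j)
      show ?case
      proof (cases "i = j")
        case True
        then show ?thesis using step[OF s(1)] by simp
      next
        case False
        then have "p ^ (s + 8) dvd x j" using Suc by simp
        then have "p ^ (s + 8) \<le> x j" using x[of j] by (intro dvd_imp_le) auto
        then have "p ^ (s + 8 + 8) dvd x (Suc j)" using step[of "s + 8" j] by simp
        then show ?thesis by (rule dvd_trans[rotated]) (simp add: le_imp_power_dvd)
      qed
    qed simp
    \<comment> \<open>The witness is \<open>T = s + 8\<close>: one factor \<open>p\<close> absorbs
      \<open>3 * R\<close>, and \<open>x i < p ^ (s + 1)\<close>.\<close>
    have "3 * R * int (x i) \<le> int p * int (x i)"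
      using p(2) R by (intro mult_right_mono) auto
    also have "\<dots> < int p * int p ^ (s + 1)"
    proof -
      have "int (x i) < int (p ^ (s + 1))" using s(2) by (simp only: of_nat_less_iff)
      then show ?thesis using p2 by simp
    qed
    also have "\<dots> = int p ^ (s + 2)" by simp
    also have "\<dots> \<le> int p ^ (s + 8)" using p2 by (intro power_increasing) auto
    finally show ?thesis
      using dvd by (intro exI[of _ "s + 8"]) (simp flip: of_nat_power)
  qed
  moreover have "profile (int p) (N + 1) V (\<Sum>j\<in>S. int (x j)) = profile (int p) (N + 1) V (int n)"
    if "finite S" "S \<noteq> {}" for S
    using c(2)[rule_format, of "\<Sum>j\<in>S. x j" n] sums[OF that] n(2) by simp
  moreover have "prime (int p)" "int p > 6 * R" using p by simp_all
  moreover have "(\<Sum>j<N. \<bar>r j\<bar>) \<le> R" by (simp add: R_def)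
  moreover have "int (x j) \<ge> 1" for j using x[of j] by simp
  ultimately show False
    using no_row_with_same_profile[of "int p" R r N "\<lambda>j. int (x j)"
        "profile (int p) (N + 1) V (int n)"] R row
    unfolding V_def by simp
qed

theorem theorem4p5:
  shows "rapidly_ipr \<infinity> \<infinity> (\<lambda>i j. rat_of_int (finite_sums_matrix i j)) \<and>
    (\<forall>r :: nat \<Rightarrow> int.
       finite {j. r j \<noteq> 0} \<and> (\<forall>i. r \<noteq> finite_sums_matrix i) \<longrightarrow>
       \<not> rapidly_ipr \<infinity> \<infinity> (\<lambda>i j. rat_of_int (adjoin_row r finite_sums_matrix i j)))"
  using rapidly_ipr_finite_sums_matrix not_rapidly_ipr_adjoin_row by blast

end
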